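(* Let $\varphi\in SN$ and let $\psi:\mathbb{R}\to(0,\infty)$ be a $\varphi$-slowly varying function. Let $\phi>0$ be any continuously differentiable function interpolating $\psi$ with respect to $\varphi$. Then $$\psi(x)=c(x)\phi(x)\quad\text{for some positive function }c\text{ with }c(x)\to1\text{ as }x\to\infty,$$ i.e. $\psi\sim\phi\in\mathcal{C}^1$, so that $\phi$ is $\varphi$-slowly varying, and also $$\left|\varphi(x)\frac{\phi'(x)}{\phi(x)}\right|\to0\quad\text{as }x\to\infty.$$ This yields the representation $$\psi(x)=c(x)\phi(x)=c(x)\exp\left(\int_0^x\frac{e(u)}{\varphi(u)}\,du\right),\quad\text{for some }e\in\mathcal{C}^1\text{ with }e(u)\to0\text{ as }u\to\infty.$$ Moreover, if $\psi$ has the Baire property (respectively, is measurable), then so does (respectively, is) $c$. Furthermore, if $\psi\in SN$ (in particular when $\psi=\varphi$), then: (i) $\phi$ is self-neglecting and $\psi(x)\sim\phi(x)\sim\int_0^x e(u)\,du$ for some continuous $e$ with $e(u)\to0$ as $u\to\infty$; (ii) both $\phi(x)/x\to0$ and $\psi(x)/x\to0$ as $x\to\infty$; (iii) if $f$ is $\psi$-regularly varying with index $\rho$, then $f$ is $\phi$-regularly varying with index $\rho$, with $\psi\sim\phi\in\mathcal{C}^1\cap SN$.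
   Context: A function $\varphi:\mathbb{R}\to(0,\infty)$ is self-neglecting, written $\varphi\in SN$, if $\varphi(x+t\varphi(x))/\varphi(x)\to 1$ as $x\to\infty$, locally uniformly in $t\in\mathbb{R}$. For $\varphi\in SN$, a function $f:\mathbb{R}\to(0,\infty)$ that has the Baire property or is Lebesgue measurable is $\varphi$-regularly varying with index $\rho\in\mathbb{R}$ if $f(x+t\varphi(x))/f(x)\to e^{\rho t}$ as $x\to\infty$ for every $t\in\mathbb{R}$. It is $\varphi$-slowly varying if $f(x+t\varphi(x))/f(x)\to1$ as $x\to\infty$ for every $t\in\mathbb{R}$ (index $0$). Interpolating functions: for $\varphi\in SN$ set $x_{n+1}:=x_n+\varphi(x_n)$ for $n\ge1$, with $x_1>0$ chosen large enough that $x_n\to\infty$, and put $x_0=0$. A function $\phi>0$ is said to interpolate $\psi$ with respect to $\varphi$ if it is continuously differentiable and (a) $\phi(x_n)=\psi(x_n)$ for $n=0,1,2,\dots$; (b) $\phi(x)$ lies between $\psi(x_{n-1})$ and $\psi(x_n)$ for $x$ between $x_{n-1}$ and $x_n$, $n=1,2,\dots$; (c) $|\phi'(x)|\le 2|\psi(x_n)-\psi(x_{n-1})|/\varphi(x_{n-1})$ for $x$ between $x_{n-1}$ and $x_n$, $n=1,2,\dots$. For positive functions, $\psi\sim\phi$ means $\psi(x)/\phi(x)\to1$ as $x\to\infty$. $\mathcal{C}^1$ denotes the continuously differentiable functions.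
   Formalization: The exponential representation is false as written. Proved instead: for the given φ and c it carries a factor φ(0), with e in C¹ if φ' and the SN function φ are C¹; and, if that SN function is Lebesgue measurable, ψ=c·exp(∫e/φ) with e in C¹ and a possibly different c. *)

theory Defs
  imports "HOL-Analysis.Analysis" "HOL-Library.Landau_Symbols"
begin

unbundle asymp_equiv_syntax

definition meagre :: "real set \<Rightarrow> bool" where
  "meagre S \<longleftrightarrow> (\<exists>A :: nat \<Rightarrow> real set. (\<forall>n. interior (closure (A n)) = {}) \<and> S \<subseteq> (\<Union>n. A n))"

definition baire_set :: "real set \<Rightarrow> bool" where
  "baire_set S \<longleftrightarrow> (\<exists>U. open U \<and> meagre (sym_diff S U))"

definition baire_fun :: "(real \<Rightarrow> real) \<Rightarrow> bool" where
  "baire_fun f \<longleftrightarrow> (\<forall>V. open V \<longrightarrow> baire_set (f -` V))"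

text \<open>Local uniformity in \<open>t\<close> is rendered as uniformity on compact sets of \<open>t\<close>.
  No regularity of \<open>\<phi>\<close> is part of the definition.\<close>

definition self_neglecting :: "(real \<Rightarrow> real) \<Rightarrow> bool" where
  "self_neglecting \<phi> \<longleftrightarrow> (\<forall>x. 0 < \<phi> x) \<and>
     (\<forall>K. compact K \<longrightarrow> uniform_limit K (\<lambda>x t. \<phi> (x + t * \<phi> x) / \<phi> x) (\<lambda>_. 1) at_top)"

definition beurling_regularly_varying :: "(real \<Rightarrow> real) \<Rightarrow> real \<Rightarrow> (real \<Rightarrow> real) \<Rightarrow> bool" where
  "beurling_regularly_varying \<phi> \<rho> f \<longleftrightarrow> (\<forall>x. 0 < f x) \<and>
     (baire_fun f \<or> f \<in> borel_measurable lebesgue) \<and>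
     (\<forall>t. ((\<lambda>x. f (x + t * \<phi> x) / f x) \<longlongrightarrow> exp (\<rho> * t)) at_top)"

definition beurling_slowly_varying :: "(real \<Rightarrow> real) \<Rightarrow> (real \<Rightarrow> real) \<Rightarrow> bool" where
  "beurling_slowly_varying \<phi> f \<longleftrightarrow> (\<forall>x. 0 < f x) \<and>
     (baire_fun f \<or> f \<in> borel_measurable lebesgue) \<and>
     (\<forall>t. ((\<lambda>x. f (x + t * \<phi> x) / f x) \<longlongrightarrow> 1) at_top)"

text \<open>The recursion \<open>x\<^sub>n\<^sub>+\<^sub>1 = x\<^sub>n + \<phi> x\<^sub>n\<close> starts at index 1; the node \<open>x\<^sub>0 = 0\<close> is
  adjoined separately, so that \<open>x\<^sub>1 - x\<^sub>0\<close> is unrelated to \<open>\<phi> x\<^sub>0\<close>.\<close>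

fun beurling_seq :: "(real \<Rightarrow> real) \<Rightarrow> real \<Rightarrow> nat \<Rightarrow> real" where
  "beurling_seq \<phi> x\<^sub>1 0 = 0"
| "beurling_seq \<phi> x\<^sub>1 (Suc 0) = x\<^sub>1"
| "beurling_seq \<phi> x\<^sub>1 (Suc (Suc n)) =
     beurling_seq \<phi> x\<^sub>1 (Suc n) + \<phi> (beurling_seq \<phi> x\<^sub>1 (Suc n))"

text \<open>The starting point \<open>x\<^sub>1\<close> may be any positive number from which the recursion diverges.\<close>

definition interpolates :: "(real \<Rightarrow> real) \<Rightarrow> (real \<Rightarrow> real) \<Rightarrow> (real \<Rightarrow> real) \<Rightarrow> bool" where
  "interpolates \<phi> \<psi> \<Phi> \<longleftrightarrow> (\<forall>x. 0 < \<Phi> x) \<and> \<Phi> C1_differentiable_on UNIV \<and>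
     (\<exists>x\<^sub>1>0. let x = beurling_seq \<phi> x\<^sub>1 in
        filterlim x at_top sequentially \<and>
        (\<forall>n. \<Phi> (x n) = \<psi> (x n)) \<and>
        (\<forall>n. \<forall>y\<in>{x n..x (Suc n)}.
           min (\<psi> (x n)) (\<psi> (x (Suc n))) \<le> \<Phi> y \<and> \<Phi> y \<le> max (\<psi> (x n)) (\<psi> (x (Suc n)))) \<and>
        (\<forall>n. \<forall>y\<in>{x n..x (Suc n)}.
           \<bar>deriv \<Phi> y\<bar> \<le> 2 * \<bar>\<psi> (x (Suc n)) - \<psi> (x n)\<bar> / \<phi> (x n)))"

end

theory Submission
  imports Defs
begin

text \<open>Everything rests on uniform convergence of \<open>f (x + u \<phi> x) / f x\<close> for \<open>u\<close> in compact sets.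
  Given this, each \<open>x\<close> in a block \<open>[x\<^sub>n, x\<^sub>n + \<phi> x\<^sub>n]\<close> has \<open>\<psi> x \<sim> \<psi> x\<^sub>n\<close>, so an interpolating function
  is asymptotic to \<open>\<psi>\<close> and its logarithmic derivative is \<open>o(1 / \<phi>)\<close>. For the representations with
  a smooth integrand, \<open>e\<close> is a sum of bumps, one per block, with heights chosen so that the primitive
  of \<open>e / \<phi>\<close> takes the values of \<open>ln \<circ> \<psi>\<close> at the nodes; the heights are comparable to the increments
  of \<open>ln \<circ> \<psi>\<close> between nodes and hence tend to 0. The same construction with \<open>\<phi> := \<Phi>\<close> and \<open>\<Phi>\<close> in
  place of \<open>ln \<circ> \<psi>\<close> gives the integral representation of a self-neglecting \<open>\<Phi>\<close>; here \<open>\<Phi>'\<close> itself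
  need not tend to 0 when \<open>\<psi> \<noteq> \<phi>\<close>.\<close>

section \<open>Sets and functions with the Baire property\<close>

text \<open>A self-neglecting function is assumed neither continuous nor measurable, and this shapes
  the argument. The regularity of \<open>f\<close> is exploited only in the shift variable
  \<open>s\<close>, where \<open>\<phi> z\<close> is a mere constant. The Baire and the Lebesgue
  case are both treated as measurability for a sigma-algebra on the line that is stable under affine
  substitutions; they part only at the claim that two sets, each nearly full, must meet along an
  affine map close to a translation. Two integral representations occur because the natural
  integrand \<open>\<phi> x * (deriv \<Phi> x / \<Phi> x)\<close> reproduces \<open>\<Phi>\<close>
  exactly but is only as smooth as \<open>\<phi>\<close> and \<open>deriv \<Phi>\<close>. A C^1
  integrand in the general case is obtained without \<open>\<Phi>\<close>, by matching
  \<open>ln (\<psi> x)\<close> at nodes; the factor \<open>c\<close> is then another one, and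
  measurability of \<open>\<phi>\<close> enters through the integrability of
  \<open>e u / \<phi> u\<close>.\<close>

lemma meagre_subset: "meagre T" if "meagre S" "T \<subseteq> S"
  using that unfolding meagre_def by (meson subset_trans)

lemma meagre_nowhere_dense: "meagre S" if "interior (closure S) = {}"
  using that unfolding meagre_def by (intro exI[of _ "\<lambda>_. S"]) auto

lemma meagre_UN:
  fixes S :: "nat \<Rightarrow> real set"
  assumes "\<And>n. meagre (S n)"
  shows "meagre (\<Union>n. S n)"
proof -
  have "\<forall>n. \<exists>A :: nat \<Rightarrow> real set. (\<forall>k. interior (closure (A k)) = {}) \<and> S n \<subseteq> (\<Union>k. A k)"
    using assms unfolding meagre_def by blast
  from choice[OF this] obtain A :: "nat \<Rightarrow> nat \<Rightarrow> real set"
    where A: "\<And>n k. interior (closure (A n k)) = {}" "\<And>n. S n \<subseteq> (\<Union>k. A n k)"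
    by blast
  show ?thesis
    unfolding meagre_def
  proof (intro exI[of _ "\<lambda>m. case_prod A (prod_decode m)"] conjI allI subsetI)
    show "interior (closure (case_prod A (prod_decode m))) = {}" for m
      by (cases "prod_decode m") (simp add: A)
    fix x assume "x \<in> (\<Union>n. S n)"
    then obtain n k where "x \<in> A n k" using A(2) by blast
    then show "x \<in> (\<Union>m. case_prod A (prod_decode m))"
      by (intro UN_I[of "prod_encode (n, k)"]) auto
  qed
qed

lemma meagre_Un: "meagre (S \<union> T)" if "meagre S" "meagre T"
proof -
  have "meagre (\<Union>n::nat. if n = 0 then S else T)" by (rule meagre_UN) (simp add: that)
  then show ?thesis by (rule meagre_subset) (auto intro: exI[of _ 0] exI[of _ 1])
qed

text \<open>The Baire category theorem: the complements of the sets \<open>closure (A n)\<close> are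
  open and dense, so their intersection is dense and would meet any nonempty open set.\<close>

lemma open_not_meagre:
  fixes U :: "real set"
  assumes "open U" "meagre U"
  shows "U = {}"
proof -
  obtain A :: "nat \<Rightarrow> real set" where A: "\<And>n. interior (closure (A n)) = {}" "U \<subseteq> (\<Union>n. A n)"
    using assms(2) unfolding meagre_def by blast
  have "UNIV \<subseteq> closure (\<Inter> (range (\<lambda>n. - closure (A n))))"
    by (rule Baire) (auto simp: closure_complement A)
  then have "closure (\<Inter>n. - closure (A n)) = UNIV" by auto
  moreover have "U \<inter> (\<Inter>n. - closure (A n)) = {}"
  proof -
    have "x \<notin> (\<Inter>n. - closure (A n))" if x: "x \<in> U" for x
    proof -
      obtain n where "x \<in> A n" using A(2) x by blast
      then have "x \<in> closure (A n)" using closure_subset by blast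
      then show ?thesis by blast
    qed
    then show ?thesis by blast
  qed
  ultimately show ?thesis
    using assms(1) by (metis inf_top_right open_Int_closure_eq_empty)
qed

text \<open>For nonzero \<open>c\<close> the map is a homeomorphism of the line: its inverse
  \<open>?R\<close> would carry an open set inside the closure of the preimage to an open set inside
  \<open>closure (A n)\<close>.\<close>

lemma meagre_affine_vimage:
  fixes c d :: real
  assumes "c \<noteq> 0" "meagre S"
  shows "meagre ((\<lambda>x. d + c * x) -` S)"
proof -
  let ?T = "\<lambda>x. d + c * x" and ?R = "\<lambda>y. (y - d) / c"
  obtain A :: "nat \<Rightarrow> real set" where A: "\<And>n. interior (closure (A n)) = {}" "S \<subseteq> (\<Union>n. A n)"
    using assms(2) unfolding meagre_def by blast
  have "interior (closure (?T -` A n)) = {}" for n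
  proof -
    let ?O = "interior (closure (?T -` A n))"
    have "closure (?T -` A n) \<subseteq> ?T -` closure (A n)"
      by (rule closure_minimal)
        (use closure_subset in \<open>auto intro!: closed_vimage continuous_intros\<close>)
    then have "?O \<subseteq> ?T -` closure (A n)"
      using interior_subset by fastforce
    then have "?R -` ?O \<subseteq> closure (A n)"
      using assms(1) by (auto simp: subset_iff)
    moreover have "open (?R -` ?O)"
      using assms(1) by (intro open_vimage continuous_intros) auto
    ultimately have "?R -` ?O = {}"
      using A(1) interior_maximal by (metis subset_empty)
    then have "?T x \<notin> ?R -` ?O" for x by simp
    then show ?thesis using assms(1) by auto
  qed
  then show ?thesis
    unfolding meagre_def using A(2) by (intro exI[of _ "\<lambda>n. ?T -` A n"]) (auto dest!: subsetD[OF A(2)])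
qed

lemma baire_set_open: "open U \<Longrightarrow> baire_set U"
  unfolding baire_set_def by (intro exI[of _ U]) (auto intro: meagre_nowhere_dense)

text \<open>If \<open>U\<close> approximates \<open>S\<close>, then \<open>- U\<close> approximates
  \<open>- S\<close> but is only closed. Passing to its interior removes a closed set with empty
  interior, which is another meagre error.\<close>

lemma baire_set_Compl:
  assumes "baire_set S"
  shows "baire_set (- S)"
proof -
  obtain U where U: "open U" "meagre (sym_diff S U)"
    using assms unfolding baire_set_def by blast
  have "interior (closure (- U - interior (- U))) = {}"
  proof -
    have "closed (- U - interior (- U))" using U(1) by (intro closed_Diff) (auto simp: closed_Compl)
    moreover have "interior (- U - interior (- U)) = {}"
      using interior_mono[of "- U - interior (- U)" "- U"]
        interior_subset[of "- U - interior (- U)"] by blast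
    ultimately show ?thesis by (simp add: closure_closed)
  qed
  then have "meagre (sym_diff S U \<union> (- U - interior (- U)))"
    using U(2) meagre_Un meagre_nowhere_dense by blast
  then have "meagre (sym_diff (- S) (interior (- U)))"
    by (rule meagre_subset) (use interior_subset in fastforce)
  then show ?thesis unfolding baire_set_def by blast
qed

lemma baire_set_UN:
  fixes S :: "nat \<Rightarrow> real set"
  assumes "\<And>n. baire_set (S n)"
  shows "baire_set (\<Union>n. S n)"
proof -
  obtain U where U: "\<And>n. open (U n)" "\<And>n. meagre (sym_diff (S n) (U n))"
    using assms unfolding baire_set_def by metis
  have "meagre (sym_diff (\<Union>n. S n) (\<Union>n. U n))"
    by (rule meagre_subset[OF meagre_UN[of "\<lambda>n. sym_diff (S n) (U n)", OF U(2)]]) blast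
  then show ?thesis unfolding baire_set_def using U(1) by blast
qed

text \<open>Packaging the Baire property as measurability makes the closure properties of measurable
  functions (logarithm, difference, quotient, composition) available for it. Only the sigma-algebra
  matters, not the measure attached to it.\<close>

definition baire_algebra :: "real measure" where
  "baire_algebra = sigma UNIV (Collect baire_set)"

lemma sigma_algebra_baire: "sigma_algebra UNIV (Collect baire_set)"
  unfolding sigma_algebra_iff2
  by (auto simp: baire_set_open Compl_eq_Diff_UNIV[symmetric] intro: baire_set_Compl baire_set_UN)

lemma sets_baire_algebra [simp]: "sets baire_algebra = Collect baire_set"
  unfolding baire_algebra_def
  by (simp add: sigma_algebra.sigma_sets_eq[OF sigma_algebra_baire])

lemma space_baire_algebra [simp]: "space baire_algebra = UNIV"
  unfolding baire_algebra_def by simp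

lemma baire_fun_iff_measurable: "baire_fun f \<longleftrightarrow> f \<in> borel_measurable baire_algebra"
proof
  assume "baire_fun f"
  then show "f \<in> borel_measurable baire_algebra"
    by (intro borel_measurableI) (simp add: baire_fun_def)
next
  assume f: "f \<in> borel_measurable baire_algebra"
  show "baire_fun f"
    unfolding baire_fun_def using measurable_sets[OF f, of V for V] by auto
qed

lemma continuous_imp_measurable_baire:
  fixes f :: "real \<Rightarrow> real"
  assumes "continuous_on UNIV f"
  shows "f \<in> borel_measurable baire_algebra"
  using assms by (intro borel_measurableI) (simp add: baire_set_open open_vimage)

lemma measurable_baire_affine:
  fixes c d :: real
  assumes "f \<in> borel_measurable baire_algebra" "c \<noteq> 0"
  shows "(\<lambda>s. f (d + c * s)) \<in> borel_measurable baire_algebra"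
proof -
  have "(\<lambda>s. d + c * s) \<in> baire_algebra \<rightarrow>\<^sub>M baire_algebra"
  proof (rule measurableI)
    fix S assume "S \<in> sets baire_algebra"
    then obtain U where U: "open U" "meagre (sym_diff S U)"
      by (auto simp: baire_set_def)
    have "open ((\<lambda>s. d + c * s) -` U)"
      by (intro open_vimage U continuous_intros)
    moreover have "meagre (sym_diff ((\<lambda>s. d + c * s) -` S) ((\<lambda>s. d + c * s) -` U))"
      by (rule meagre_subset[OF meagre_affine_vimage[OF assms(2) U(2), of d]]) auto
    ultimately show "(\<lambda>s. d + c * s) -` S \<inter> space baire_algebra \<in> sets baire_algebra"
      by (auto simp: baire_set_def)
  qed auto
  from measurable_compose[OF this assms(1)] show ?thesis .
qed

lemma measurable_lebesgue_affine:
  fixes c d :: real and f :: "real \<Rightarrow> real"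
  assumes "f \<in> borel_measurable lebesgue" "c \<noteq> 0"
  shows "(\<lambda>s. f (d + c * s)) \<in> borel_measurable lebesgue"
proof -
  have "(\<lambda>s. d + c * s) \<in> lebesgue \<rightarrow>\<^sub>M lebesgue"
    using lebesgue_affine_measurable[of "\<lambda>_::real. c" d] assms(2) by simp
  from measurable_compose[OF this assms(1)] show ?thesis .
qed

section \<open>Steinhaus-type overlap, in category and in measure\<close>

text \<open>The tail intersections of each sequence exhaust the line, so by category one of them is
  comeagre in some nonempty open set. Two such open sets that overlap under the limiting translation
  still overlap under the map for large \<open>n\<close>, and the nonempty open overlap is not
  covered by the two meagre exceptional sets.\<close>

lemma overlap_baire:
  fixes A B :: "nat \<Rightarrow> real set" and u c :: "nat \<Rightarrow> real"
  assumes "\<And>n. A n \<in> sets baire_algebra" "\<And>n. B n \<in> sets baire_algebra"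
    and "\<And>s. eventually (\<lambda>n. s \<in> A n) sequentially"
    and "\<And>s. eventually (\<lambda>n. s \<in> B n) sequentially"
    and u: "u \<longlonglongrightarrow> u0" and c: "c \<longlonglongrightarrow> 1"
  shows "\<exists>n. \<exists>s\<in>{0..1}. s \<in> B n \<and> u n + c n * s \<in> A n"
proof -
  have open_part: "\<exists>N J. open J \<and> J \<noteq> {} \<and> J \<subseteq> I \<and> meagre (J - (\<Inter>n\<in>{N..}. D n))"
    if D: "\<And>n. D n \<in> sets baire_algebra" "\<And>s. eventually (\<lambda>n. s \<in> D n) sequentially"
      and I: "open I" "I \<noteq> {}" for D :: "nat \<Rightarrow> real set" and I
  proof -
    define V where "V N = (\<Inter>n\<in>{N..}. D n)" for N :: nat
    have "V N \<in> sets baire_algebra" for N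
      unfolding V_def using D(1) baire_set_open[OF open_UNIV]
      by (intro sets.countable_INT'') auto
    then obtain U where U: "\<And>N. open (U N)" "\<And>N. meagre (sym_diff (V N) (U N))"
      by (simp add: baire_set_def) metis
    have "I \<subseteq> (\<Union>N. V N)"
      using D(2) by (fastforce simp: V_def eventually_sequentially)
    have "\<exists>N. U N \<inter> I \<noteq> {}"
    proof (rule ccontr)
      assume *: "\<nexists>N. U N \<inter> I \<noteq> {}"
      have "I \<subseteq> (\<Union>N. sym_diff (V N) (U N))"
      proof
        fix x assume "x \<in> I"
        then obtain N where "x \<in> V N" using \<open>I \<subseteq> (\<Union>N. V N)\<close> by blast
        moreover have "x \<notin> U N" using * \<open>x \<in> I\<close> by blast
        ultimately show "x \<in> (\<Union>N. sym_diff (V N) (U N))" by blast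
      qed
      then have "meagre I"
        using meagre_UN[of "\<lambda>n. sym_diff (V n) (U n)", OF U(2)] meagre_subset by blast
      then show False using open_not_meagre[of I] I by blast
    qed
    then obtain N where N: "U N \<inter> I \<noteq> {}" by blast
    have "meagre (U N \<inter> I - V N)"
      by (rule meagre_subset[OF U(2)[of N]]) auto
    then show ?thesis
      unfolding V_def using N U(1) I by (intro exI[of _ N] exI[of _ "U N \<inter> I"]) auto
  qed
  obtain M J where J: "open J" "J \<noteq> {}" "J \<subseteq> {0<..<1}" "meagre (J - (\<Inter>n\<in>{M..}. B n))"
    using open_part[of B "{0<..<1}"] assms by auto
  \<comment> \<open>The open set for \<open>A\<close> is sought inside the translate of
    \<open>J\<close> by \<open>u0\<close>. Then some \<open>q\<close> in \<open>J\<close> has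
    \<open>u0 + q\<close> in \<open>I\<close>, and since \<open>I\<close> is open this persists for
    \<open>u n + c n * q\<close> with \<open>n\<close> large.\<close>
  have "open ((+) u0 ` J)" "(+) u0 ` J \<noteq> {}"
    using J by (auto simp: open_translation)
  then obtain N I where I: "open I" "I \<noteq> {}" "I \<subseteq> (+) u0 ` J" "meagre (I - (\<Inter>n\<in>{N..}. A n))"
    using open_part[of A "(+) u0 ` J"] assms by metis
  then obtain q where q: "q \<in> J" "u0 + q \<in> I" by auto
  have "(\<lambda>n. u n + c n * q) \<longlonglongrightarrow> u0 + 1 * q"
    by (intro tendsto_intros u c)
  then have "eventually (\<lambda>n. u n + c n * q \<in> I) sequentially"
    using topological_tendstoD[of _ _ _ I] I(1) q(2) by simp
  moreover have "eventually (\<lambda>n. c n > 0) sequentially"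
    using order_tendstoD(1)[OF c] by simp
  ultimately have "eventually (\<lambda>n. u n + c n * q \<in> I \<and> c n > 0 \<and> n \<ge> M \<and> n \<ge> N) sequentially"
    using eventually_ge_at_top[of M] eventually_ge_at_top[of N] by eventually_elim auto
  then obtain n where n: "u n + c n * q \<in> I" "c n > 0" "n \<ge> M" "n \<ge> N"
    using eventually_happens'[OF sequentially_bot] by blast
  let ?T = "\<lambda>s. u n + c n * s"
  have "open (J \<inter> ?T -` I)"
    by (intro open_Int J(1) open_vimage I(1) continuous_intros)
  moreover have "J \<inter> ?T -` I \<noteq> {}" using q n by auto
  ultimately have "\<not> meagre (J \<inter> ?T -` I)" using open_not_meagre by blast
  moreover have "meagre ((J - (\<Inter>n\<in>{M..}. B n)) \<union> ?T -` (I - (\<Inter>n\<in>{N..}. A n)))"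
    using J(4) I(4) n by (intro meagre_Un meagre_affine_vimage) auto
  ultimately have "\<not> J \<inter> ?T -` I \<subseteq> (J - (\<Inter>n\<in>{M..}. B n)) \<union> ?T -` (I - (\<Inter>n\<in>{N..}. A n))"
    using meagre_subset by metis
  then obtain s where "s \<in> J" "s \<in> (\<Inter>n\<in>{M..}. B n)" "?T s \<in> (\<Inter>n\<in>{N..}. A n)"
    by auto
  then show ?thesis
    using n J(3) by (intro exI[of _ n] bexI[of _ s]) auto
qed

text \<open>The measure counterpart: by continuity from above the exceptional parts of a bounded
  interval become small. If no overlap occurred, the image of the good part of \<open>{0..1}\<close>
  would lie in the exceptional part for \<open>A\<close>, although its measure is at least 3/8 and
  the latter has measure below 1/4.\<close>

lemma overlap_lebesgue:
  fixes A B :: "nat \<Rightarrow> real set" and u c :: "nat \<Rightarrow> real"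
  assumes "\<And>n. A n \<in> sets lebesgue" "\<And>n. B n \<in> sets lebesgue"
    and "\<And>s. eventually (\<lambda>n. s \<in> A n) sequentially"
    and "\<And>s. eventually (\<lambda>n. s \<in> B n) sequentially"
    and u: "u \<longlonglongrightarrow> u0" and c: "c \<longlonglongrightarrow> 1"
  shows "\<exists>n. \<exists>s\<in>{0..1}. s \<in> B n \<and> u n + c n * s \<in> A n"
proof -
  have large_part: "\<exists>N. measure lebesgue ({a..b} - (\<Inter>n\<in>{N..}. D n)) < 1/4"
    if D: "\<And>n. D n \<in> sets lebesgue" "\<And>s. eventually (\<lambda>n. s \<in> D n) sequentially"
    for D :: "nat \<Rightarrow> real set" and a b
  proof -
    let ?E = "\<lambda>N. {a..b} - (\<Inter>n\<in>{N..}. D n)"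
    have E: "?E N \<in> lmeasurable" for N
      using D(1) by (intro fmeasurable_Diff) (auto intro: sets.countable_INT'')
    have "(\<lambda>N. measure lebesgue (?E N)) \<longlonglongrightarrow> measure lebesgue (\<Inter>N. ?E N)"
    proof (rule Lim_measure_decseq)
      show "range ?E \<subseteq> sets lebesgue" using E by (auto simp: fmeasurable_def)
      show "decseq ?E" by (force simp: decseq_def)
      show "emeasure lebesgue (?E N) \<noteq> \<infinity>" for N using E[of N] by (auto simp: fmeasurable_def)
    qed
    moreover have "(\<Inter>N. ?E N) = {}"
      using D(2) by (fastforce simp: eventually_sequentially)
    ultimately have "(\<lambda>N. measure lebesgue (?E N)) \<longlonglongrightarrow> 0" by (metis measure_empty)
    then have "eventually (\<lambda>N. measure lebesgue (?E N) < 1/4) sequentially"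
      by (rule order_tendstoD) simp
    then show ?thesis using eventually_happens'[OF sequentially_bot] by blast
  qed
  obtain M where M: "measure lebesgue ({0..1} - (\<Inter>n\<in>{M..}. B n)) < 1/4"
    using large_part[of B 0 1] assms by auto
  \<comment> \<open>This interval contains every \<open>u n + c n * s\<close> with \<open>s\<close>
    in \<open>{0..1}\<close> once \<open>u n\<close> is within 1 of \<open>u0\<close> and
    \<open>c n\<close> lies between 1/2 and 2.\<close>
  obtain N where N: "measure lebesgue ({u0-1..u0+3} - (\<Inter>n\<in>{N..}. A n)) < 1/4"
    using large_part[of A "u0-1" "u0+3"] assms by auto
  have "eventually (\<lambda>n. c n > 1/2 \<and> c n < 2 \<and> u n > u0 - 1 \<and> u n < u0 + 1 \<and> n \<ge> M \<and> n \<ge> N) sequentially"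
    using order_tendstoD(1)[OF c, of "1/2"] order_tendstoD(2)[OF c, of 2]
      order_tendstoD(1)[OF u, of "u0 - 1"] order_tendstoD(2)[OF u, of "u0 + 1"]
      eventually_ge_at_top[of M] eventually_ge_at_top[of N]
    by (auto simp: eventually_conj_iff)
  then obtain n where n: "c n > 1/2" "c n < 2" "u n > u0 - 1" "u n < u0 + 1" "n \<ge> M" "n \<ge> N"
    using eventually_happens'[OF sequentially_bot] by blast
  define W where "W = {0..1} \<inter> (\<Inter>n\<in>{M..}. B n)"
  define Z where "Z = {u0-1..u0+3} - (\<Inter>n\<in>{N..}. A n)"
  have BM: "(\<Inter>n\<in>{M..}. B n) \<in> sets lebesgue" and AN: "(\<Inter>n\<in>{N..}. A n) \<in> sets lebesgue"
    using assms by (auto intro: sets.countable_INT'')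
  have W: "W \<in> lmeasurable" and Z: "Z \<in> lmeasurable"
    unfolding W_def Z_def using BM AN by (auto intro!: fmeasurable_Diff fmeasurable_Int_fmeasurable)
  have "measure lebesgue ({0..1} - W) = measure lebesgue {0..1::real} - measure lebesgue W"
    using W by (intro measurable_measure_Diff) (auto simp: W_def)
  moreover have "{0..1} - W = {0..1} - (\<Inter>n\<in>{M..}. B n)" unfolding W_def by auto
  ultimately have W34: "measure lebesgue W > 3/4" using M by simp
  have "\<exists>s\<in>W. u n + c n * s \<in> (\<Inter>n\<in>{N..}. A n)"
  proof (rule ccontr)
    assume *: "\<not> ?thesis"
    have "(\<lambda>s. c n * s + u n) ` W \<subseteq> Z"
    proof (rule image_subsetI)
      fix s assume s: "s \<in> W"
      then have "0 \<le> s" "s \<le> 1" by (auto simp: W_def)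
      then have "0 \<le> c n * s" "c n * s \<le> 2"
        using n mult_mono[of "c n" 2 s 1] by auto
      then show "c n * s + u n \<in> Z"
        using * s n by (auto simp: Z_def add.commute)
    qed
    then have "emeasure lebesgue ((\<lambda>s. c n * s + u n) ` W) \<le> emeasure lebesgue Z"
      using Z by (intro emeasure_mono) auto
    then have "measure lebesgue ((\<lambda>s. c n * s + u n) ` W) \<le> measure lebesgue Z"
      unfolding measure_def using Z by (intro enn2real_mono) (auto simp: fmeasurable_def)
    then have "c n * measure lebesgue W < 1/4"
      using measure_lebesgue_affine[of "c n" "u n" W] n N by (simp add: Z_def)
    moreover have "c n * measure lebesgue W \<ge> 1/2 * (3/4)"
      using n W34 by (intro mult_mono) auto
    ultimately show False by simp
  qed
  then show ?thesis
    using n by (intro exI[of _ n]) (auto simp: W_def)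
qed

section \<open>Self-neglecting functions and uniform convergence\<close>

lemma self_neglecting_pos: "self_neglecting \<phi> \<Longrightarrow> 0 < \<phi> x"
  unfolding self_neglecting_def by blast

lemma self_neglecting_uniformD:
  assumes "self_neglecting \<phi>" "0 < \<epsilon>"
  shows "eventually (\<lambda>x. \<forall>t. \<bar>t\<bar> \<le> K \<longrightarrow> \<bar>\<phi> (x + t * \<phi> x) / \<phi> x - 1\<bar> < \<epsilon>) at_top"
proof -
  have "uniform_limit {-K..K} (\<lambda>x t. \<phi> (x + t * \<phi> x) / \<phi> x) (\<lambda>_. 1) at_top"
    using assms(1) unfolding self_neglecting_def by blast
  from uniform_limitD[OF this assms(2)] show ?thesis
    by (rule eventually_mono) (auto simp: dist_real_def abs_le_iff)
qed

text \<open>If \<open>\<phi> x \<ge> \<delta> x\<close> then \<open>t = - x / \<phi> x\<close> lies in a fixed compact set and moves \<open>x\<close> to \<open>0\<close>,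
  so that \<open>\<phi> x\<close> is comparable to \<open>\<phi> 0\<close>.\<close>

lemma self_neglecting_sublinear:
  assumes "self_neglecting \<phi>"
  shows "((\<lambda>x. \<phi> x / x) \<longlongrightarrow> 0) at_top"
proof (rule tendstoI)
  fix \<delta> :: real assume "0 < \<delta>"
  note pos = self_neglecting_pos[OF assms]
  have "eventually (\<lambda>x. \<forall>t. \<bar>t\<bar> \<le> 1/\<delta> \<longrightarrow> \<bar>\<phi> (x + t * \<phi> x) / \<phi> x - 1\<bar> < 1/2) at_top"
    by (rule self_neglecting_uniformD[OF assms]) simp
  then show "eventually (\<lambda>x. dist (\<phi> x / x) 0 < \<delta>) at_top"
    \<comment> \<open>Beyond this threshold \<open>2 * \<phi> 0 < \<delta> * x\<close>, which is
      incompatible with \<open>\<phi> x < 2 * \<phi> 0\<close> and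
      \<open>\<delta> * x \<le> \<phi> x\<close>.\<close>
    using eventually_gt_at_top[of "2 * \<phi> 0 / \<delta>"]
  proof eventually_elim
    case (elim x)
    have "x > 0" using elim(2) pos[of 0] \<open>0 < \<delta>\<close> by (smt (verit) divide_pos_pos)
    show ?case
    proof (rule ccontr)
      assume "\<not> ?thesis"
      then have le: "\<delta> * x \<le> \<phi> x"
        using \<open>x > 0\<close> pos[of x] by (simp add: dist_real_def field_simps)
      have "\<bar>- x / \<phi> x\<bar> \<le> 1/\<delta>"
        using le \<open>x > 0\<close> \<open>0 < \<delta>\<close> pos[of x] by (simp add: field_simps)
      then have "\<bar>\<phi> (x + (- x / \<phi> x) * \<phi> x) / \<phi> x - 1\<bar> < 1/2"
        using elim(1) by blast
      then have "\<bar>\<phi> 0 / \<phi> x - 1\<bar> < 1/2" using pos[of x] by simp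
      then have "\<phi> 0 / \<phi> x > 1/2" by linarith
      then have "\<phi> x < 2 * \<phi> 0" using pos[of x] by (simp add: field_simps)
      moreover have "2 * \<phi> 0 < \<delta> * x"
        using elim(2) \<open>0 < \<delta>\<close> by (simp add: field_simps)
      ultimately show False using le by simp
    qed
  qed
qed

text \<open>Sublinearity makes a bounded multiple of \<open>\<phi> x\<close> smaller than
  \<open>x / 2\<close> for large \<open>x\<close>. Hence shifted points also tend to infinity, and
  limits at infinity may be taken along them.\<close>

lemma self_neglecting_shift:
  assumes "self_neglecting \<phi>"
  shows "eventually (\<lambda>x. \<forall>t. \<bar>t\<bar> \<le> K \<longrightarrow> Z \<le> x + t * \<phi> x) at_top"
proof -
  note pos = self_neglecting_pos[OF assms]
  let ?\<delta> = "1 / (2 * (\<bar>K\<bar> + 1))"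
  have "eventually (\<lambda>x. \<phi> x / x < ?\<delta>) at_top"
    by (rule order_tendstoD(2)[OF self_neglecting_sublinear[OF assms]]) simp
  then show ?thesis
    using eventually_gt_at_top[of 0] eventually_ge_at_top[of "2 * Z"]
  proof eventually_elim
    case (elim x)
    show ?case
    proof (intro allI impI)
      fix t assume "\<bar>t\<bar> \<le> K"
      have "2 * ((\<bar>K\<bar> + 1) * \<phi> x) < x"
        using elim by (simp add: field_simps)
      moreover have "\<bar>t * \<phi> x\<bar> \<le> (\<bar>K\<bar> + 1) * \<phi> x"
        unfolding abs_mult using \<open>\<bar>t\<bar> \<le> K\<close> pos[of x] by (intro mult_mono) auto
      ultimately show "Z \<le> x + t * \<phi> x" using elim by linarith
    qed
  qed
qed

lemma self_neglecting_shift_at_top: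
  assumes "self_neglecting \<phi>" "filterlim x at_top F" "eventually (\<lambda>n. \<bar>u n\<bar> \<le> K) F"
  shows "filterlim (\<lambda>n. x n + u n * \<phi> (x n)) at_top F"
  unfolding filterlim_at_top
proof
  fix Z :: real
  from filterlim_iff[THEN iffD1, OF assms(2), rule_format,
      OF self_neglecting_shift[OF assms(1), of K Z]] assms(3)
  show "eventually (\<lambda>n. Z \<le> x n + u n * \<phi> (x n)) F"
    by eventually_elim blast
qed

lemma self_neglecting_ratio_tendsto:
  assumes "self_neglecting \<phi>" "filterlim x at_top F" "eventually (\<lambda>n. \<bar>u n\<bar> \<le> K) F"
  shows "((\<lambda>n. \<phi> (x n + u n * \<phi> (x n)) / \<phi> (x n)) \<longlongrightarrow> 1) F"
proof (rule tendstoI)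
  fix \<epsilon> :: real assume "0 < \<epsilon>"
  from filterlim_iff[THEN iffD1, OF assms(2), rule_format,
      OF self_neglecting_uniformD[OF assms(1) this, of K]] assms(3)
  show "eventually (\<lambda>n. dist (\<phi> (x n + u n * \<phi> (x n)) / \<phi> (x n)) 1 < \<epsilon>) F"
    by eventually_elim (simp add: dist_real_def)
qed

text \<open>At a point \<open>y = x + u \<phi> x\<close> one has \<open>y + s \<phi> y = x + (u + c s) \<phi> x\<close> with \<open>c = \<phi> y / \<phi> x\<close>
  near \<open>1\<close>. By the overlap lemmas some \<open>s\<close> makes both increments of \<open>ln \<circ> f\<close>, from \<open>x\<close> and from
  \<open>y\<close> to this common point, close to their limits; \<open>\<phi>\<close> itself need not be measurable.\<close>

lemma beurling_uniform_convergence: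
  fixes f \<phi> :: "real \<Rightarrow> real"
  assumes sn: "self_neglecting \<phi>" and rv: "beurling_regularly_varying \<phi> \<rho> f" and "0 < \<epsilon>"
  shows "eventually (\<lambda>x. \<forall>u. \<bar>u\<bar> \<le> K \<longrightarrow>
           \<bar>ln (f (x + u * \<phi> x)) - ln (f x) - \<rho> * u\<bar> < \<epsilon>) at_top"
proof (rule ccontr)
  define h where "h x u = ln (f (x + u * \<phi> x)) - ln (f x) - \<rho> * u" for x u
  note pos = self_neglecting_pos[OF sn]
  have fpos: "0 < f x" for x using rv unfolding beurling_regularly_varying_def by blast
  assume "\<not> ?thesis"
  then have "\<forall>n::nat. \<exists>x u. real n \<le> x \<and> \<bar>u\<bar> \<le> K \<and> \<epsilon> \<le> \<bar>h x u\<bar>"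
    unfolding eventually_at_top_linorder h_def by (metis linorder_not_less)
  then obtain x0 u0 where 0: "\<And>n::nat. real n \<le> x0 n" "\<And>n. \<bar>u0 n\<bar> \<le> K" "\<And>n. \<epsilon> \<le> \<bar>h (x0 n) (u0 n)\<bar>"
    by metis
  \<comment> \<open>The overlap lemmas require convergent shifts, so the counterexamples are thinned
    to a subsequence; \<open>n \<le> r n\<close> keeps their base points going to infinity.\<close>
  have "seq_compact {-K..K}" by (simp add: compact_imp_seq_compact)
  moreover have "\<forall>n. u0 n \<in> {-K..K}" using 0(2) by (auto simp: abs_le_iff minus_le_iff)
  ultimately obtain l r where r: "strict_mono (r :: nat \<Rightarrow> nat)" "(u0 \<circ> r) \<longlonglongrightarrow> l"
    unfolding seq_compact_def by blast
  define x where "x n = x0 (r n)" for n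
  define u where "u n = u0 (r n)" for n
  have u: "u \<longlonglongrightarrow> l" using r(2) unfolding u_def o_def .
  have uK: "\<bar>u n\<bar> \<le> K" for n using 0(2) by (simp add: u_def)
  have x: "filterlim x at_top sequentially"
  proof (rule filterlim_at_top_mono[OF filterlim_real_sequentially], rule always_eventually, rule allI)
    show "real n \<le> x n" for n
      using 0(1)[of "r n"] strict_mono_imp_increasing[OF r(1), of n] by (simp add: x_def)
  qed
  define y where "y n = x n + u n * \<phi> (x n)" for n
  define c where "c n = \<phi> (y n) / \<phi> (x n)" for n
  have y: "filterlim y at_top sequentially"
    unfolding y_def by (rule self_neglecting_shift_at_top[where K = K, OF sn x]) (simp add: uK)
  have c: "c \<longlonglongrightarrow> 1"
    unfolding c_def y_def by (rule self_neglecting_ratio_tendsto[where K = K, OF sn x]) (simp add: uK)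
  \<comment> \<open>Three errors below \<open>\<delta>\<close> are added at the end. The third,
    \<open>\<rho> * (c n - 1) * s\<close>, comes from the change of scale between the two base
    points; its bound does not involve \<open>s\<close> and is built into \<open>B\<close>.\<close>
  define \<delta> where "\<delta> = \<epsilon> / 4"
  have \<delta>: "0 < \<delta>" using \<open>0 < \<epsilon>\<close> by (simp add: \<delta>_def)
  define A where "A n = {s. \<bar>h (x n) s\<bar> < \<delta>}" for n
  define B where "B n = {s. \<bar>h (y n) s\<bar> < \<delta> \<and> \<bar>\<rho> * (c n - 1)\<bar> < \<delta>}" for n
  have small: "eventually (\<lambda>n. \<bar>h (z n) s\<bar> < \<delta>) sequentially"
    if z: "filterlim z at_top sequentially" for z s
  proof -
    have "((\<lambda>x. f (x + s * \<phi> x) / f x) \<longlongrightarrow> exp (\<rho> * s)) at_top"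
      using rv unfolding beurling_regularly_varying_def by blast
    then have "(\<lambda>n. f (z n + s * \<phi> (z n)) / f (z n)) \<longlonglongrightarrow> exp (\<rho> * s)"
      using z by (rule filterlim_compose)
    then have "(\<lambda>n. ln (f (z n + s * \<phi> (z n)) / f (z n))) \<longlonglongrightarrow> ln (exp (\<rho> * s))"
      by (rule tendsto_ln) simp
    then have "(\<lambda>n. ln (f (z n + s * \<phi> (z n))) - ln (f (z n))) \<longlonglongrightarrow> \<rho> * s"
      using fpos by (simp add: ln_div less_imp_neq[THEN not_sym])
    from tendstoD[OF this \<delta>] show ?thesis
      by (simp add: dist_real_def h_def)
  qed
  have evA: "eventually (\<lambda>n. s \<in> A n) sequentially" for s
    using small[OF x] by (simp add: A_def)
  have "(\<lambda>n. \<rho> * (c n - 1)) \<longlonglongrightarrow> \<rho> * (1 - 1)" by (intro tendsto_intros c)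
  from tendstoD[OF this \<delta>] have "eventually (\<lambda>n. \<bar>\<rho> * (c n - 1)\<bar> < \<delta>) sequentially"
    by (simp add: dist_real_def)
  then have evB: "eventually (\<lambda>n. s \<in> B n) sequentially" for s
    using small[OF y] by (simp add: B_def eventually_conj_iff)
  \<comment> \<open>Stated for an arbitrary \<open>M\<close> to serve both regularity classes. In
    \<open>s\<close> the values \<open>z\<close> and \<open>\<phi> z\<close> are constants, and so
    is \<open>P\<close>, which stands for the second condition in \<open>B\<close>.\<close>
  have meas: "{s. \<bar>h z s\<bar> < \<delta> \<and> P} \<in> sets M"
    if M: "(\<lambda>s. f (z + \<phi> z * s)) \<in> borel_measurable M" "(\<lambda>s. s) \<in> borel_measurable M"
      "space M = UNIV" for M z P
  proof -
    have [measurable]: "(\<lambda>s. f (z + s * \<phi> z)) \<in> borel_measurable M"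
      using M(1) by (simp add: mult.commute)
    note [measurable] = M(2)
    have "{s \<in> space M. \<bar>h z s\<bar> < \<delta> \<and> P} \<in> sets M"
      unfolding h_def by measurable
    then show ?thesis using M(3) by simp
  qed
  have "\<exists>n. \<exists>s\<in>{0..1}. s \<in> B n \<and> u n + c n * s \<in> A n"
  proof (cases "baire_fun f")
    case True
    then have M: "(\<lambda>s. f (z + \<phi> z * s)) \<in> borel_measurable baire_algebra" for z
      using pos[of z] by (intro measurable_baire_affine) (simp_all add: baire_fun_iff_measurable)
    have I: "(\<lambda>s. s) \<in> borel_measurable baire_algebra"
      by (rule continuous_imp_measurable_baire) (rule continuous_on_id)
    show ?thesis
      using meas[OF M I] meas[OF M I, of _ True]
      by (intro overlap_baire[OF _ _ evA evB u c]) (simp_all add: A_def B_def)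
  next
    case False
    then have "f \<in> borel_measurable lebesgue"
      using rv unfolding beurling_regularly_varying_def by blast
    then have M: "(\<lambda>s. f (z + \<phi> z * s)) \<in> borel_measurable lebesgue" for z
      using pos[of z] by (intro measurable_lebesgue_affine) simp_all
    have I: "(\<lambda>s::real. s) \<in> borel_measurable lebesgue" by (rule measurable_completion) simp
    show ?thesis
      using meas[OF M I] meas[OF M I, of _ True]
      by (intro overlap_lebesgue[OF _ _ evA evB u c]) (simp_all add: A_def B_def)
  qed
  then obtain n s where s: "0 \<le> s" "s \<le> 1" "s \<in> B n" "u n + c n * s \<in> A n"
    by auto
  have "x n + (u n + c n * s) * \<phi> (x n) = y n + s * \<phi> (y n)"
    using pos[of "x n"] by (simp add: y_def c_def field_simps)
  then have eq: "h (x n) (u n) = h (x n) (u n + c n * s) - h (y n) s + \<rho> * (c n - 1) * s"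
    by (simp add: h_def y_def[symmetric] algebra_simps)
  have "\<bar>\<rho> * (c n - 1) * s\<bar> \<le> \<bar>\<rho> * (c n - 1)\<bar> * 1"
    unfolding abs_mult[of _ s] using s by (intro mult_left_mono) auto
  moreover have "\<bar>\<rho> * (c n - 1)\<bar> < \<delta>" "\<bar>h (y n) s\<bar> < \<delta>" "\<bar>h (x n) (u n + c n * s)\<bar> < \<delta>"
    using s by (auto simp: A_def B_def)
  ultimately have "\<bar>h (x n) (u n)\<bar> < \<epsilon>"
    unfolding eq \<delta>_def by linarith
  then show False using 0(3)[of "r n"] by (simp add: x_def u_def)
qed

lemma beurling_slowly_varying_iff:
  "beurling_slowly_varying \<phi> f \<longleftrightarrow> beurling_regularly_varying \<phi> 0 f"
  by (simp add: beurling_slowly_varying_def beurling_regularly_varying_def)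

text \<open>The form in which uniformity is applied from here on: the shift may move with the base
  point as long as it stays bounded.\<close>

lemma beurling_uniform_ratio_tendsto:
  assumes sn: "self_neglecting \<phi>" and rv: "beurling_regularly_varying \<phi> \<rho> f"
    and x: "filterlim x at_top F" and u: "eventually (\<lambda>n. \<bar>u n\<bar> \<le> K) F"
  shows "((\<lambda>n. ln (f (x n + u n * \<phi> (x n))) - ln (f (x n)) - \<rho> * u n) \<longlongrightarrow> 0) F"
proof (rule tendstoI)
  fix \<epsilon> :: real assume "0 < \<epsilon>"
  from filterlim_iff[THEN iffD1, OF x, rule_format,
      OF beurling_uniform_convergence[OF sn rv this, of K]] u
  show "eventually (\<lambda>n. dist (ln (f (x n + u n * \<phi> (x n))) - ln (f (x n)) - \<rho> * u n) 0 < \<epsilon>) F"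
    by eventually_elim (simp add: dist_real_def)
qed

section \<open>Smooth integrands with prescribed primitives\<close>

text \<open>Meant for locally finite sums: the series of bumps below agrees near each point with a
  finite partial sum, though the number of terms depends on the point.\<close>

lemma C1_differentiable_on_UNIV_local:
  fixes f :: "real \<Rightarrow> real"
  assumes "\<And>x. \<exists>U g. open U \<and> x \<in> U \<and> g C1_differentiable_on UNIV \<and> (\<forall>y\<in>U. f y = g y)"
  shows "f C1_differentiable_on UNIV"
proof -
  have "f differentiable at x \<and> isCont (\<lambda>x. vector_derivative f (at x)) x" for x
  proof -
    obtain U g where U: "open U" "x \<in> U" "g C1_differentiable_on UNIV" "\<And>y. y \<in> U \<Longrightarrow> f y = g y"
      using assms[of x] by metis
    have "(f has_vector_derivative vector_derivative g (at y)) (at y)" if "y \<in> U" for y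
    proof (rule has_vector_derivative_transform_within_open[OF _ U(1) that])
      show "(g has_vector_derivative vector_derivative g (at y)) (at y)"
        using U(3) by (simp add: C1_differentiable_on_eq vector_derivative_works)
    qed (simp add: U)
    then have f: "f differentiable at y" "vector_derivative f (at y) = vector_derivative g (at y)"
      if "y \<in> U" for y
      using that by (auto intro: differentiableI_vector vector_derivative_at)
    have "eventually (\<lambda>y. vector_derivative f (at y) = vector_derivative g (at y)) (nhds x)"
      using f(2) U(1,2) eventually_nhds by blast
    moreover have "isCont (\<lambda>x. vector_derivative g (at x)) x"
      using U(3) by (simp add: C1_differentiable_on_eq continuous_on_eq_continuous_at)
    ultimately have "isCont (\<lambda>x. vector_derivative f (at x)) x" by (simp only: isCont_cong)
    then show ?thesis using f(1)[OF U(2)] by blast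
  qed
  then show ?thesis
    by (simp add: C1_differentiable_on_eq continuous_on_eq_continuous_at)
qed

lemma C1_differentiable_on_sum:
  fixes f :: "'i \<Rightarrow> real \<Rightarrow> real"
  shows "(\<And>i. i \<in> I \<Longrightarrow> f i C1_differentiable_on S) \<Longrightarrow> (\<lambda>x. \<Sum>i\<in>I. f i x) C1_differentiable_on S"
  by (induction I rule: infinite_finite_induct) auto

text \<open>Squaring smooths the corner of the truncation: at 0 the difference quotient is bounded
  by \<open>\<bar>h\<bar>\<close>. This supplies the C^1 factors of the bump.\<close>

lemma has_real_derivative_max0_square:
  "((\<lambda>s::real. (max 0 s)\<^sup>2) has_real_derivative 2 * max 0 s) (at s)"
proof -
  consider "s < 0" | "s = 0" | "s > 0" by linarith
  then show ?thesis
  proof cases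
    case 1
    have "((\<lambda>s::real. 0) has_real_derivative 2 * max 0 s) (at s)" using 1 by simp
    then show ?thesis
      by (rule has_field_derivative_transform_within_open[of _ _ _ "{..<0}"]) (use 1 in auto)
  next
    case 2
    have "((\<lambda>h::real. (max 0 h)\<^sup>2 / h) \<longlongrightarrow> 0) (at 0)"
    proof (rule Lim_null_comparison)
      show "((\<lambda>h::real. \<bar>h\<bar>) \<longlongrightarrow> 0) (at 0)" using tendsto_rabs[OF tendsto_ident_at[of 0 UNIV]] by simp
      show "\<forall>\<^sub>F h in at 0. norm ((max 0 h)\<^sup>2 / h) \<le> \<bar>h::real\<bar>"
        by (rule always_eventually) (auto simp: max_def power2_eq_square)
    qed
    then show ?thesis using 2 by (simp add: has_field_derivative_iff)
  next
    case 3
    have "((\<lambda>s::real. s\<^sup>2) has_real_derivative 2 * max 0 s) (at s)"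
      using 3 by (auto intro!: derivative_eq_intros)
    then show ?thesis
      by (rule has_field_derivative_transform_within_open[of _ _ _ "{0<..}"]) (use 3 in auto)
  qed
qed

lemma C1_max0_affine_square: "(\<lambda>s::real. (max 0 (a + b * s))\<^sup>2) C1_differentiable_on UNIV"
  unfolding C1_differentiable_on_def
proof (intro exI[of _ "\<lambda>s. 2 * max 0 (a + b * s) * b"] conjI ballI)
  show "((\<lambda>s. (max 0 (a + b * s))\<^sup>2) has_vector_derivative 2 * max 0 (a + b * s) * b) (at s)" for s
    unfolding has_real_derivative_iff_has_vector_derivative[symmetric]
    by (rule DERIV_chain2[OF has_real_derivative_max0_square])
      (auto intro!: derivative_eq_intros)
qed (intro continuous_intros)

text \<open>The polynomial \<open>s\<^sup>2 * (1 - s)\<^sup>2\<close> on the unit interval, extended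
  by 0; the double zeros at both ends make the extension C^1.\<close>

definition bump :: "real \<Rightarrow> real" where
  "bump s = (max 0 s)\<^sup>2 * (max 0 (1 - s))\<^sup>2"

lemma bump_nonneg: "0 \<le> bump s"
  by (simp add: bump_def)

lemma bump_le_1: "bump s \<le> 1"
proof (cases "0 \<le> s \<and> s \<le> 1")
  case True
  then have "bump s \<le> 1 * 1"
    unfolding bump_def by (intro mult_mono power_le_one) auto
  then show ?thesis by simp
qed (auto simp: bump_def max_def)

lemma bump_eq_0: "s \<le> 0 \<or> 1 \<le> s \<Longrightarrow> bump s = 0"
  by (auto simp: bump_def max_def)

lemma bump_ge:
  assumes "1/4 \<le> s" "s \<le> 3/4"
  shows "1/256 \<le> bump s"
proof -
  have "(1/4)\<^sup>2 * (1/4)\<^sup>2 \<le> bump s"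
    unfolding bump_def using assms by (intro mult_mono power_mono) auto
  then show ?thesis by (simp add: power2_eq_square)
qed

lemma C1_bump_affine: "(\<lambda>u. bump ((u - a) / d)) C1_differentiable_on UNIV"
proof -
  have "(\<lambda>u. (max 0 (- (a / d) + (1 / d) * u))\<^sup>2 * (max 0 ((1 + a / d) + (- (1 / d)) * u))\<^sup>2)
      C1_differentiable_on UNIV"
    by (intro C1_differentiable_on_mult C1_max0_affine_square)
  then show ?thesis
    by (simp add: bump_def diff_divide_distrib algebra_simps)
qed

section \<open>Nodes and the interpolating primitive\<close>

text \<open>The first node lies beyond the point from which one step changes \<open>\<phi>\<close>
  by a factor of at most 2. This also forces divergence without continuity: at a finite limit
  \<open>L\<close> the steps \<open>\<phi> (s n)\<close> would tend to 0, while nodes within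
  \<open>\<phi> L\<close> of \<open>L\<close> have steps at least
  \<open>\<phi> L / 2\<close>.\<close>

lemma self_neglecting_nodes:
  assumes sn: "self_neglecting \<phi>"
  obtains s :: "nat \<Rightarrow> real" where "0 < s 0" "\<And>n. s (Suc n) = s n + \<phi> (s n)"
    "filterlim s at_top sequentially"
    "\<And>n u. s n \<le> u \<Longrightarrow> u \<le> s (Suc n) \<Longrightarrow> \<phi> (s n) / 2 \<le> \<phi> u \<and> \<phi> u \<le> 2 * \<phi> (s n)"
proof -
  note pos = self_neglecting_pos[OF sn]
  have "eventually (\<lambda>x. \<forall>t. \<bar>t\<bar> \<le> 1 \<longrightarrow> \<bar>\<phi> (x + t * \<phi> x) / \<phi> x - 1\<bar> < 1/2) at_top"
    by (rule self_neglecting_uniformD[OF sn]) simp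
  then obtain X0 where X0: "\<And>x t. X0 \<le> x \<Longrightarrow> \<bar>t\<bar> \<le> 1 \<Longrightarrow> \<bar>\<phi> (x + t * \<phi> x) / \<phi> x - 1\<bar> < 1/2"
    unfolding eventually_at_top_linorder by blast
  have near: "\<phi> x / 2 \<le> \<phi> u \<and> \<phi> u \<le> 2 * \<phi> x" if "X0 \<le> x" "\<bar>u - x\<bar> \<le> \<phi> x" for x u
  proof -
    have "\<bar>(u - x) / \<phi> x\<bar> \<le> 1" using that(2) pos[of x] by (simp add: abs_divide divide_le_eq)
    from X0[OF that(1) this] have "\<bar>\<phi> u / \<phi> x - 1\<bar> < 1/2" using pos[of x] by simp
    then have "1/2 < \<phi> u / \<phi> x" "\<phi> u / \<phi> x < 2" by linarith+
    then show ?thesis using pos[of x] by (auto simp: field_simps)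
  qed
  define s where "s n = ((\<lambda>y. y + \<phi> y) ^^ n) (max 1 X0)" for n
  have s0: "s 0 = max 1 X0" and Suc: "s (Suc n) = s n + \<phi> (s n)" for n
    by (simp_all add: s_def)
  have inc: "incseq s"
    by (rule incseq_SucI) (use Suc pos less_imp_le in auto)
  have ge: "X0 \<le> s n" for n
    using incseqD[OF inc, of 0 n] s0 by simp
  have "filterlim s at_top sequentially"
  proof (rule ccontr)
    assume notlim: "\<not> ?thesis"
    have "\<exists>B. \<forall>n. s n \<le> B"
    proof (rule ccontr)
      assume "\<nexists>B. \<forall>n. s n \<le> B"
      then have "\<exists>n. Z < s n" for Z by (meson not_le)
      then have "filterlim s at_top sequentially"
        unfolding filterlim_at_top eventually_sequentially
        by (meson inc incseqD less_imp_le order_trans)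
      then show False using notlim by blast
    qed
    then obtain L where L: "s \<longlonglongrightarrow> L" "\<And>n. s n \<le> L"
      using incseq_convergent[OF inc] by blast
    have "X0 \<le> L" using ge[of 0] L(2)[of 0] by simp
    have "(\<lambda>n. s (Suc n) - s n) \<longlonglongrightarrow> L - L"
      by (intro tendsto_diff L(1) LIMSEQ_Suc)
    then have "(\<lambda>n. \<phi> (s n)) \<longlonglongrightarrow> 0" by (simp add: Suc)
    moreover have "eventually (\<lambda>n. \<bar>s n - L\<bar> < \<phi> L) sequentially"
      using tendstoD[OF L(1) pos] by (simp add: dist_real_def)
    then have "eventually (\<lambda>n. \<phi> L / 2 \<le> \<phi> (s n)) sequentially"
      by eventually_elim (use near[OF \<open>X0 \<le> L\<close>] in auto)
    ultimately have "\<phi> L / 2 \<le> 0"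
      using tendsto_lowerbound sequentially_bot by blast
    then show False using pos[of L] by simp
  qed
  moreover have "\<phi> (s n) / 2 \<le> \<phi> u \<and> \<phi> u \<le> 2 * \<phi> (s n)" if "s n \<le> u" "u \<le> s (Suc n)" for n u
    using near[OF ge[of n], of u] that Suc[of n] by auto
  ultimately show ?thesis using that s0 Suc by (metis less_max_iff_disj zero_less_one)
qed

text \<open>Converts estimates block by block into limits as \<open>x\<close> grows. Minimality of
  the index gives the left inequality, except for index 0, where it is the assumption on
  \<open>x\<close>.\<close>

lemma node_index:
  fixes s :: "nat \<Rightarrow> real"
  assumes inc: "incseq s" and lim: "filterlim s at_top sequentially"
  obtains N :: "real \<Rightarrow> nat" where "\<And>x. s 0 \<le> x \<Longrightarrow> s (N x) \<le> x \<and> x \<le> s (Suc (N x))"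
    "filterlim N at_top at_top"
proof -
  define N where "N x = (LEAST n. x < s (Suc n))" for x
  have N: "x < s (Suc (N x))" for x
  proof -
    have "eventually (\<lambda>n. x < s n) sequentially"
      using lim by (simp add: filterlim_at_top_dense)
    then have "\<exists>n. x < s (Suc n)"
      unfolding eventually_sequentially by (meson le_SucI order_refl)
    then show ?thesis unfolding N_def by (rule LeastI_ex)
  qed
  have below: "s (Suc m) \<le> x" if "m < N x" for m x
    using that not_less_Least[of m "\<lambda>n. x < s (Suc n)"] unfolding N_def by auto
  have "s (N x) \<le> x \<and> x \<le> s (Suc (N x))" if "s 0 \<le> x" for x
    using N[of x] that below[of "N x - 1" x] by (cases "N x") auto
  moreover have "filterlim N at_top at_top"
    unfolding filterlim_at_top
  proof
    fix k
    have "k \<le> N x" if "s k \<le> x" for x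
    proof (rule ccontr)
      assume "\<not> k \<le> N x"
      then have "s (Suc (N x)) \<le> s k" using incseqD[OF inc] by auto
      then show False using N[of x] that by simp
    qed
    then show "eventually (\<lambda>x. k \<le> N x) at_top"
      using eventually_ge_at_top[of "s k"] by (rule eventually_mono[rotated])
  qed
  ultimately show ?thesis using that by blast
qed

text \<open>Here \<open>y x\<close> is the node preceding \<open>x\<close>, and \<open>C\<close> comes from the lower bound \<open>1 / 1024\<close> on the
  integral of a bump over its block.\<close>

lemma primitive_interpolation:
  fixes \<phi> g :: "real \<Rightarrow> real"
  assumes sn: "self_neglecting \<phi>" and meas: "\<phi> \<in> borel_measurable lebesgue"
  obtains e y :: "real \<Rightarrow> real" and C where "e C1_differentiable_on UNIV"
    "\<And>a b. (\<lambda>u. e u / \<phi> u) absolutely_integrable_on {a..b}"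
    "\<And>x. x \<le> 0 \<Longrightarrow> e x = 0" "filterlim y at_top at_top"
    "eventually (\<lambda>x. y x \<le> x \<and> x \<le> y x + \<phi> (y x) \<and>
       \<bar>e x\<bar> \<le> C * \<bar>g (y x + \<phi> (y x)) - g (y x)\<bar> \<and>
       \<bar>integral {0..x} (\<lambda>u. e u / \<phi> u) - g (y x)\<bar> \<le> \<bar>g (y x + \<phi> (y x)) - g (y x)\<bar>) at_top"
proof -
  note pos = self_neglecting_pos[OF sn]
  obtain s :: "nat \<Rightarrow> real" where s0: "0 < s 0" and Suc: "\<And>n. s (Suc n) = s n + \<phi> (s n)"
    and lim: "filterlim s at_top sequentially"
    and near: "\<And>n u. s n \<le> u \<Longrightarrow> u \<le> s (Suc n) \<Longrightarrow> \<phi> (s n) / 2 \<le> \<phi> u \<and> \<phi> u \<le> 2 * \<phi> (s n)"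
    using self_neglecting_nodes[OF sn] by metis
  have inc: "incseq s"
    by (rule incseq_SucI) (use Suc pos less_imp_le in auto)
  define b where "b n u = bump ((u - s n) / \<phi> (s n))" for n u
  define h where "h n u = b n u / \<phi> u" for n u
  have b_C1: "b n C1_differentiable_on UNIV" for n
    unfolding b_def by (rule C1_bump_affine)
  have b01: "0 \<le> b n u" "b n u \<le> 1" for n u
    unfolding b_def by (rule bump_nonneg bump_le_1)+
  have b_out: "b n u = 0" if "u \<le> s n \<or> s (Suc n) \<le> u" for n u
    unfolding b_def using that pos[of "s n"] by (intro bump_eq_0) (auto simp: Suc field_simps)
  have h_nonneg: "0 \<le> h n u" for n u
    unfolding h_def using b01 pos[of u] by (intro divide_nonneg_pos)
  have h_le: "h n u \<le> 2 / \<phi> (s n)" for n u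
  proof (cases "s n \<le> u \<and> u \<le> s (Suc n)")
    case True
    then have "h n u \<le> 1 / (\<phi> (s n) / 2)"
      unfolding h_def using near[of n u] b01 pos by (intro frac_le) auto
    then show ?thesis by simp
  next
    case False
    then show ?thesis using b_out[of u n] pos[of "s n"] by (auto simp: h_def)
  qed
  \<comment> \<open>Here measurability of \<open>\<phi>\<close> is used: together with the bound by
    twice the reciprocal of the block length it makes the quotient integrable on bounded
    intervals.\<close>
  have h_int: "h n absolutely_integrable_on {x..z}" for n x z
  proof (rule measurable_bounded_by_integrable_imp_absolutely_integrable)
    have "continuous_on UNIV (b n)" using b_C1 by (rule C1_differentiable_imp_continuous_on)
    then have "b n \<in> borel_measurable lebesgue"
      by (intro measurable_completion) (simp add: borel_measurable_continuous_onI)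
    then have "h n \<in> borel_measurable lebesgue" unfolding h_def using meas by measurable
    then show "h n \<in> borel_measurable (lebesgue_on {x..z})" by (rule measurable_restrict_space1)
    show "(\<lambda>_. 2 / \<phi> (s n)) integrable_on {x..z}" by (rule integrable_const_ivl)
    show "norm (h n u) \<le> 2 / \<phi> (s n)" for u using h_nonneg h_le by simp
  qed simp
  have h_hk: "h n integrable_on {x..z}" for n x z
    using h_int by (rule set_lebesgue_integral_eq_integral)
  define I where "I n = integral {s n..s (Suc n)} (h n)" for n
  have I_ge: "1 / 1024 \<le> I n" for n
  proof -
    let ?d = "\<phi> (s n)"
    let ?J = "{s n + ?d / 4..s n + 3 * ?d / 4}"
    have J: "?J \<subseteq> {s n..s (Suc n)}" using pos[of "s n"] by (auto simp: Suc)
    \<comment> \<open>The middle half of the block has length \<open>?d / 2\<close>. There the bump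
      is at least 1/256, the fourth power of 1/4, and \<open>\<phi>\<close> is at most
      \<open>2 * ?d\<close>.\<close>
    have "1 / 1024 = integral ?J (\<lambda>_. 1 / (512 * ?d))"
      using pos[of "s n"] by (simp add: field_simps)
    also have "\<dots> \<le> integral ?J (h n)"
    proof (rule integral_le)
      fix u assume u: "u \<in> ?J"
      then have "1/256 \<le> b n u"
        unfolding b_def using pos[of "s n"] by (intro bump_ge) (auto simp: field_simps)
      then have "(1/256) / (2 * ?d) \<le> h n u"
        unfolding h_def using near[of n u] u J pos by (intro frac_le) auto
      then show "1 / (512 * ?d) \<le> h n u" by simp
    qed (rule integrable_const_ivl h_hk)+
    also have "\<dots> \<le> I n"
      unfolding I_def by (rule integral_subset_le[OF J h_hk h_hk]) (simp add: h_nonneg)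
    finally show ?thesis .
  qed
  have I_pos: "0 < I n" for n using I_ge[of n] by simp
  \<comment> \<open>The primitive is 0 at \<open>s 0\<close>, whatever \<open>g (s 0)\<close> may
    be. The first bump therefore carries all of \<open>g (s 1)\<close>, and agreement with
    \<open>g\<close> at nodes holds from index 1 on; this is why the final estimates require
    \<open>1 \<le> N x\<close>.\<close>
  define \<Delta> where "\<Delta> n = g (s (Suc n)) - (if n = 0 then 0 else g (s n))" for n
  define a where "a n = \<Delta> n / I n" for n
  have a_le: "\<bar>a n\<bar> \<le> 1024 * \<bar>\<Delta> n\<bar>" for n
  proof -
    have "\<bar>a n\<bar> \<le> \<bar>\<Delta> n\<bar> / (1 / 1024)"
      unfolding a_def abs_divide using I_ge[of n] by (intro frac_le) auto
    then show ?thesis by simp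
  qed
  \<comment> \<open>At each point at most one term is nonzero, since the bumps live on consecutive
    blocks and vanish at the nodes.\<close>
  define e where "e u = (\<Sum>n. a n * b n u)" for u
  have e_sum: "e u = (\<Sum>n<M. a n * b n u)" if "u \<le> s M" for u M
    unfolding e_def
  proof (rule suminf_finite)
    fix n assume "n \<notin> {..<M}"
    then have "s M \<le> s n" using incseqD[OF inc] by simp
    then show "a n * b n u = 0" using that b_out[of u n] by simp
  qed simp
  have e_on: "e u = a n * b n u" if "s n \<le> u" "u \<le> s (Suc n)" for u n
  proof -
    have "a m * b m u = 0" if "m < n" for m
      using incseqD[OF inc, of "Suc m" n] that \<open>s n \<le> u\<close> b_out[of u m] by simp
    then have "(\<Sum>m<n. a m * b m u) = 0" by (intro sum.neutral) blast
    then show ?thesis by (simp add: e_sum[OF that(2)])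
  qed
  have e_0: "e u = 0" if "u \<le> s 0" for u
    using e_sum[OF that] by simp
  have beyond: "\<exists>M. x < s M" for x
    using lim unfolding filterlim_at_top_dense by (meson eventually_happens' sequentially_bot)
  have "e C1_differentiable_on UNIV"
  proof (rule C1_differentiable_on_UNIV_local)
    fix x
    obtain M where M: "x < s M" using beyond by blast
    have "(\<lambda>u. \<Sum>n<M. a n * b n u) C1_differentiable_on UNIV"
      by (intro C1_differentiable_on_sum C1_differentiable_on_mult C1_differentiable_on_const b_C1)
    then show "\<exists>U g. open U \<and> x \<in> U \<and> g C1_differentiable_on UNIV \<and> (\<forall>y\<in>U. e y = g y)"
      using M e_sum by (intro exI[of _ "{..<s M}"] exI) (auto intro: less_imp_le)
  qed
  moreover have e_int: "(\<lambda>u. e u / \<phi> u) absolutely_integrable_on {x..z}" for x z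
  proof -
    obtain M where M: "z < s M" using beyond by blast
    have "(\<lambda>u. \<Sum>n<M. a n * h n u) absolutely_integrable_on {x..z}"
      by (intro absolutely_integrable_sum set_integrable_mult_right) (auto simp: h_int)
    moreover have "(\<Sum>n<M. a n * h n u) = e u / \<phi> u" if "u \<in> {x..z}" for u
      using that M by (simp add: e_sum[of u M] h_def sum_divide_distrib)
    ultimately show ?thesis
      by (subst set_integrable_cong[OF refl refl, of _ _ "\<lambda>u. \<Sum>n<M. a n * h n u"]) auto
  qed
  define G where "G x = integral {0..x} (\<lambda>u. e u / \<phi> u)" for x
  have e_hk: "(\<lambda>u. e u / \<phi> u) integrable_on {x..z}" for x z
    using e_int by (rule set_lebesgue_integral_eq_integral)
  have G_step: "G x = G (s n) + a n * integral {s n..x} (h n)" if "s n \<le> x" "x \<le> s (Suc n)" for n x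
  proof -
    have "integral {s n..x} (\<lambda>u. e u / \<phi> u) = integral {s n..x} (\<lambda>u. a n * h n u)"
      by (rule Henstock_Kurzweil_Integration.integral_cong)
        (use that in \<open>auto simp: h_def e_on[of n]\<close>)
    moreover have "G (s n) + integral {s n..x} (\<lambda>u. e u / \<phi> u) = G x"
      unfolding G_def using that s0 incseqD[OF inc, of 0 n]
      by (intro Henstock_Kurzweil_Integration.integral_combine e_hk) auto
    ultimately show ?thesis by simp
  qed
  have "G (s 0) = integral {0..s 0} (\<lambda>u. 0)"
    unfolding G_def by (rule Henstock_Kurzweil_Integration.integral_cong) (simp add: e_0)
  then have G_0: "G (s 0) = 0" by simp
  have G_Suc: "G (s (Suc n)) = g (s (Suc n))" for n
  proof (induction n)
    case 0
    show ?case
      using G_step[of 0 "s (Suc 0)"] incseqD[OF inc, of 0 "Suc 0"] I_pos[of 0] G_0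
      by (simp add: I_def[symmetric] a_def \<Delta>_def)
  next
    case (Suc n)
    then show ?case
      using G_step[of "Suc n" "s (Suc (Suc n))"] incseqD[OF inc, of "Suc n" "Suc (Suc n)"]
        I_pos[of "Suc n"]
      by (simp add: I_def[symmetric] a_def \<Delta>_def)
  qed
  \<comment> \<open>On a block the integrand has constant sign, so the primitive moves monotonically
    from one prescribed value to the next and never departs from the first by more than their
    difference.\<close>
  have G_near: "\<bar>G x - g (s n)\<bar> \<le> \<bar>\<Delta> n\<bar>" if "n \<noteq> 0" "s n \<le> x" "x \<le> s (Suc n)" for n x
  proof -
    obtain m where "n = Suc m" using \<open>n \<noteq> 0\<close> not0_implies_Suc by blast
    have le: "0 \<le> integral {s n..x} (h n)" "integral {s n..x} (h n) \<le> I n"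
      unfolding I_def using that h_nonneg h_hk
      by (auto intro!: integral_nonneg integral_subset_le)
    have "\<bar>G x - g (s n)\<bar> = \<bar>a n\<bar> * integral {s n..x} (h n)"
      using G_step[OF that(2,3)] G_Suc[of m] \<open>n = Suc m\<close> le(1) by (simp add: abs_mult)
    also have "\<dots> \<le> \<bar>a n\<bar> * I n" using le by (intro mult_left_mono) auto
    also have "\<dots> = \<bar>\<Delta> n\<bar>" using I_pos[of n] by (simp add: a_def abs_divide)
    finally show ?thesis .
  qed
  obtain N :: "real \<Rightarrow> nat" where N: "\<And>x. s 0 \<le> x \<Longrightarrow> s (N x) \<le> x \<and> x \<le> s (Suc (N x))"
    and N_lim: "filterlim N at_top at_top"
    using node_index[OF inc lim] by metis
  have "eventually (\<lambda>x. 1 \<le> N x) at_top"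
    using N_lim unfolding filterlim_at_top by blast
  then have "eventually (\<lambda>x. s (N x) \<le> x \<and> x \<le> s (N x) + \<phi> (s (N x)) \<and>
       \<bar>e x\<bar> \<le> 1024 * \<bar>g (s (N x) + \<phi> (s (N x))) - g (s (N x))\<bar> \<and>
       \<bar>integral {0..x} (\<lambda>u. e u / \<phi> u) - g (s (N x))\<bar> \<le> \<bar>g (s (N x) + \<phi> (s (N x))) - g (s (N x))\<bar>) at_top"
    using eventually_ge_at_top[of "s 0"]
  proof eventually_elim
    case (elim x)
    note x = N[OF elim(2)]
    have \<Delta>: "\<Delta> (N x) = g (s (N x) + \<phi> (s (N x))) - g (s (N x))"
      using elim(1) by (simp add: \<Delta>_def Suc)
    have "\<bar>e x\<bar> \<le> \<bar>a (N x)\<bar> * 1"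
      using x e_on[of "N x" x] b01[of "N x" x] by (simp add: abs_mult mult_left_le)
    then have "\<bar>e x\<bar> \<le> 1024 * \<bar>\<Delta> (N x)\<bar>" using a_le[of "N x"] by linarith
    moreover have "\<bar>G x - g (s (N x))\<bar> \<le> \<bar>\<Delta> (N x)\<bar>"
      using x elim(1) by (intro G_near) auto
    moreover have "x \<le> s (N x) + \<phi> (s (N x))" using x by (simp add: Suc)
    ultimately show ?case
      using x unfolding \<Delta> G_def by blast
  qed
  moreover have "filterlim (\<lambda>x. s (N x)) at_top at_top"
    using lim N_lim by (rule filterlim_compose)
  moreover have "e x = 0" if "x \<le> 0" for x using e_0[of x] s0 that by simp
  ultimately show ?thesis
    by (intro that[of e "\<lambda>x. s (N x)" 1024] e_int)
qed

section \<open>Derivatives on the line and oriented integrals from 0\<close>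

lemma C1_differentiable_on_UNIV_deriv:
  fixes f :: "real \<Rightarrow> real"
  assumes "f C1_differentiable_on UNIV"
  shows "(f has_real_derivative deriv f x) (at x)" "continuous_on UNIV (deriv f)"
    "continuous_on UNIV f"
proof -
  obtain D where D: "\<And>x. (f has_real_derivative D x) (at x)" "continuous_on UNIV D"
    using assms unfolding C1_differentiable_on_def has_real_derivative_iff_has_vector_derivative[symmetric]
    by blast
  have "deriv f = D" using D(1) DERIV_imp_deriv by blast
  then show "(f has_real_derivative deriv f x) (at x)" "continuous_on UNIV (deriv f)"
    using D by simp_all
  show "continuous_on UNIV f" using assms by (rule C1_differentiable_imp_continuous_on)
qed

lemma C1_differentiable_on_UNIV_inverse:
  fixes f :: "real \<Rightarrow> real"
  assumes f: "f C1_differentiable_on UNIV" and "\<And>x. f x \<noteq> 0"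
  shows "(\<lambda>x. inverse (f x)) C1_differentiable_on UNIV"
  unfolding C1_differentiable_on_def
proof (intro exI[of _ "\<lambda>x. - (inverse (f x) * deriv f x * inverse (f x))"] conjI ballI)
  show "((\<lambda>x. inverse (f x)) has_vector_derivative - (inverse (f x) * deriv f x * inverse (f x))) (at x)" for x
    unfolding has_real_derivative_iff_has_vector_derivative[symmetric]
    using C1_differentiable_on_UNIV_deriv(1)[OF f] assms(2) by (rule DERIV_inverse')
  show "continuous_on UNIV (\<lambda>x. - (inverse (f x) * deriv f x * inverse (f x)))"
    using assms C1_differentiable_on_UNIV_deriv[OF f] by (intro continuous_intros) auto
qed

text \<open>Links the oriented Lebesgue integral over open intervals with the gauge integral over
  closed ones: the endpoints are null, and the orientation produces the sign for negative
  \<open>x\<close>.\<close>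

lemma interval_lebesgue_integral_0_real:
  fixes h :: "real \<Rightarrow> real"
  assumes h: "\<And>a b. h absolutely_integrable_on {a..b}"
  shows "interval_lebesgue_integrable lebesgue 0 (ereal x) h"
    and "(LINT u=0..ereal x|lebesgue. h u) = (if 0 \<le> x then integral {0..x} h else - integral {x..0} h)"
proof -
  have "set_integrable lebesgue {a<..<b} h" for a b
    by (rule set_integrable_subset[OF h[of a b]]) auto
  moreover from this have "(LINT u:{a<..<b}|lebesgue. h u) = integral {a..b} h" for a b
    by (simp add: set_lebesgue_integral_eq_integral(2) integral_open_interval_real)
  ultimately show "interval_lebesgue_integrable lebesgue 0 (ereal x) h"
    "(LINT u=0..ereal x|lebesgue. h u) = (if 0 \<le> x then integral {0..x} h else - integral {x..0} h)"
    by (simp_all add: interval_lebesgue_integrable_def interval_lebesgue_integral_def zero_ereal_def)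
qed

lemma interval_lebesgue_integral_derivative:
  fixes F :: "real \<Rightarrow> real"
  assumes F: "\<And>x. (F has_real_derivative F' x) (at x)" and F': "continuous_on UNIV F'"
  shows "interval_lebesgue_integrable lebesgue 0 (ereal x) F'"
    and "(LINT u=0..ereal x|lebesgue. F' u) = F x - F 0"
proof -
  have abs: "F' absolutely_integrable_on {a..b}" for a b
    by (rule absolutely_integrable_continuous_real) (rule continuous_on_subset[OF F' subset_UNIV])
  show "interval_lebesgue_integrable lebesgue 0 (ereal x) F'"
    by (rule interval_lebesgue_integral_0_real(1)[OF abs])
  have "integral {a..b} F' = F b - F a" if "a \<le> b" for a b
    using that F by (intro integral_unique fundamental_theorem_of_calculus)
      (auto simp: has_real_derivative_iff_has_vector_derivative[symmetric]
        intro: has_field_derivative_at_within)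
  then show "(LINT u=0..ereal x|lebesgue. F' u) = F x - F 0"
    by (simp add: interval_lebesgue_integral_0_real(2)[OF abs])
qed

text \<open>When the integrand vanishes to the left of 0, the oriented integral and
  \<open>integral {0..x} h\<close>, whose range is empty for negative \<open>x\<close>, are both 0
  there, so no case distinction remains.\<close>

lemma interval_lebesgue_integral_vanishing:
  fixes h :: "real \<Rightarrow> real"
  assumes h: "\<And>a b. h absolutely_integrable_on {a..b}" and h0: "\<And>x. x \<le> 0 \<Longrightarrow> h x = 0"
  shows "(LINT u=0..ereal x|lebesgue. h u) = integral {0..x} h"
    and "continuous_on UNIV (\<lambda>x. LINT u=0..ereal x|lebesgue. h u)"
proof -
  have neg: "integral {a..b} h = 0" if "b \<le> 0" for a b
  proof -
    have "integral {a..b} h = integral {a..b} (\<lambda>_. 0)"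
      by (rule Henstock_Kurzweil_Integration.integral_cong) (use that h0 in auto)
    then show ?thesis by simp
  qed
  show eq: "(LINT u=0..ereal x|lebesgue. h u) = integral {0..x} h" for x
    by (simp add: interval_lebesgue_integral_0_real(2)[OF h] neg)
  have int: "h integrable_on {a..b}" for a b
    using h by (rule set_lebesgue_integral_eq_integral)
  have "isCont (\<lambda>x. integral {0..x} h) x" for x
  proof -
    \<comment> \<open>Moving the base point from 0 to \<open>-M\<close> leaves the integral
      unchanged and puts \<open>x\<close> in the interior of the interval, so that two-sided
      continuity follows even at 0.\<close>
    define M where "M = \<bar>x\<bar> + 1"
    have "continuous_on {-M..M} (\<lambda>x. integral {-M..x} h)"
      by (rule indefinite_integral_continuous_1[OF int])
    moreover have "integral {-M..x} h = integral {0..x} h" if "x \<in> {-M..M}" for x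
    proof (cases "0 \<le> x")
      case True
      then show ?thesis
        using Henstock_Kurzweil_Integration.integral_combine[of "-M" 0 x h] int neg[of 0 "-M"]
        by (simp add: M_def)
    qed (simp add: neg)
    ultimately have "continuous_on {-M..M} (\<lambda>x. integral {0..x} h)"
      by (rule continuous_on_eq)
    then show ?thesis
      by (rule continuous_on_interior) (auto simp: M_def)
  qed
  then show "continuous_on UNIV (\<lambda>x. LINT u=0..ereal x|lebesgue. h u)"
    unfolding eq by (simp add: continuous_on_eq_continuous_at)
qed

section \<open>Asymptotic equivalence and interpolation\<close>

lemma beurling_regularly_varying_pos: "beurling_regularly_varying \<phi> \<rho> f \<Longrightarrow> 0 < f x"
  unfolding beurling_regularly_varying_def by blast

lemma ratio_tendsto_exp:
  fixes f g :: "'a \<Rightarrow> real"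
  assumes "\<And>x. 0 < f x" "\<And>x. 0 < g x" "((\<lambda>x. ln (f x) - ln (g x)) \<longlongrightarrow> l) F"
  shows "((\<lambda>x. f x / g x) \<longlongrightarrow> exp l) F"
proof -
  have "exp (ln (f x) - ln (g x)) = f x / g x" for x
    using assms(1)[of x] assms(2)[of x] by (simp add: exp_diff)
  with tendsto_exp[OF assms(3)] show ?thesis by simp
qed

text \<open>A point of the block is \<open>y x + u * \<phi> (y x)\<close> with \<open>u\<close>
  between 0 and 1. Since \<open>u\<close> varies with \<open>x\<close>, pointwise slow variation
  would not suffice; the right end of the block is the case \<open>u = 1\<close>.\<close>

lemma slowly_varying_block:
  assumes sn: "self_neglecting \<phi>" and sv: "beurling_regularly_varying \<phi> 0 f"
    and y: "filterlim y at_top at_top"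
    and block: "eventually (\<lambda>x. y x \<le> x \<and> x \<le> y x + \<phi> (y x)) at_top"
  shows "((\<lambda>x. ln (f x) - ln (f (y x))) \<longlongrightarrow> 0) at_top"
    and "((\<lambda>x. ln (f (y x + \<phi> (y x))) - ln (f (y x))) \<longlongrightarrow> 0) at_top"
proof -
  note pos = self_neglecting_pos[OF sn]
  have "eventually (\<lambda>x. \<bar>(x - y x) / \<phi> (y x)\<bar> \<le> 1) at_top"
    using block
  proof eventually_elim
    case (elim x)
    then show ?case using pos[of "y x"] by (simp add: abs_divide divide_le_eq)
  qed
  from beurling_uniform_ratio_tendsto[OF sn sv y this] pos
  show "((\<lambda>x. ln (f x) - ln (f (y x))) \<longlongrightarrow> 0) at_top"
    by (simp add: less_imp_neq[THEN not_sym])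
  have "eventually (\<lambda>x::real. \<bar>1::real\<bar> \<le> 1) at_top" by simp
  from beurling_uniform_ratio_tendsto[OF sn sv y this]
  show "((\<lambda>x. ln (f (y x + \<phi> (y x))) - ln (f (y x))) \<longlongrightarrow> 0) at_top" by simp
qed

lemma self_neglecting_block:
  assumes sn: "self_neglecting \<phi>" and y: "filterlim y at_top at_top"
    and block: "eventually (\<lambda>x. y x \<le> x \<and> x \<le> y x + \<phi> (y x)) at_top"
  shows "((\<lambda>x. \<phi> x / \<phi> (y x)) \<longlongrightarrow> 1) at_top"
    and "((\<lambda>x. \<phi> (y x + \<phi> (y x)) / \<phi> (y x)) \<longlongrightarrow> 1) at_top"
proof -
  note pos = self_neglecting_pos[OF sn]
  have "eventually (\<lambda>x. \<bar>(x - y x) / \<phi> (y x)\<bar> \<le> 1) at_top"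
    using block
  proof eventually_elim
    case (elim x)
    then show ?case using pos[of "y x"] by (simp add: abs_divide divide_le_eq)
  qed
  from self_neglecting_ratio_tendsto[OF sn y this] pos
  show "((\<lambda>x. \<phi> x / \<phi> (y x)) \<longlongrightarrow> 1) at_top"
    by (simp add: less_imp_neq[THEN not_sym])
  have "eventually (\<lambda>x::real. \<bar>1::real\<bar> \<le> 1) at_top" by simp
  from self_neglecting_ratio_tendsto[OF sn y this]
  show "((\<lambda>x. \<phi> (y x + \<phi> (y x)) / \<phi> (y x)) \<longlongrightarrow> 1) at_top" by simp
qed

text \<open>Everything is normalised by \<open>\<psi>\<close> at the preceding node. The quotient
  \<open>R\<close> is squeezed between 1 and \<open>Q\<close>, and the derivative bound becomes
  \<open>2 * (\<phi> x / \<phi> (y x)) * \<bar>Q x - 1\<bar> / R x\<close>, in which only the factor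
  with \<open>Q\<close> is small.\<close>

lemma interpolation_asymptotics:
  assumes sn: "self_neglecting \<phi>" and sv: "beurling_regularly_varying \<phi> 0 \<psi>"
    and ip: "interpolates \<phi> \<psi> \<Phi>"
  shows "((\<lambda>x. \<Phi> x / \<psi> x) \<longlongrightarrow> 1) at_top"
    and "((\<lambda>x. \<phi> x * (deriv \<Phi> x / \<Phi> x)) \<longlongrightarrow> 0) at_top"
proof -
  note pos = self_neglecting_pos[OF sn]
  note \<psi>_pos = beurling_regularly_varying_pos[OF sv]
  have \<Phi>_pos: "0 < \<Phi> x" for x using ip unfolding interpolates_def by blast
  obtain x1 where lim0: "filterlim (beurling_seq \<phi> x1) at_top sequentially"
    and between0: "\<And>n z. z \<in> {beurling_seq \<phi> x1 n..beurling_seq \<phi> x1 (Suc n)} \<Longrightarrow>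
       min (\<psi> (beurling_seq \<phi> x1 n)) (\<psi> (beurling_seq \<phi> x1 (Suc n))) \<le> \<Phi> z \<and>
       \<Phi> z \<le> max (\<psi> (beurling_seq \<phi> x1 n)) (\<psi> (beurling_seq \<phi> x1 (Suc n)))"
    and deriv0: "\<And>n z. z \<in> {beurling_seq \<phi> x1 n..beurling_seq \<phi> x1 (Suc n)} \<Longrightarrow>
       \<bar>deriv \<Phi> z\<bar> \<le> 2 * \<bar>\<psi> (beurling_seq \<phi> x1 (Suc n)) - \<psi> (beurling_seq \<phi> x1 n)\<bar> / \<phi> (beurling_seq \<phi> x1 n)"
    using ip unfolding interpolates_def Let_def by metis
  \<comment> \<open>The index is shifted by one because the spacing rule holds only from node 1 on;
    the irregular block between 0 and the first proper node is irrelevant to the limits.\<close>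
  define s where "s n = beurling_seq \<phi> x1 (Suc n)" for n
  have Suc: "s (Suc n) = s n + \<phi> (s n)" for n by (simp add: s_def)
  have inc: "incseq s"
    by (rule incseq_SucI) (use Suc pos less_imp_le in auto)
  have lim: "filterlim s at_top sequentially"
    unfolding s_def using lim0 by (rule filterlim_compose) (rule filterlim_Suc)
  obtain N :: "real \<Rightarrow> nat" where N: "\<And>x. s 0 \<le> x \<Longrightarrow> s (N x) \<le> x \<and> x \<le> s (Suc (N x))"
    and N_lim: "filterlim N at_top at_top"
    using node_index[OF inc lim] by metis
  define y where "y x = s (N x)" for x
  define y' where "y' x = y x + \<phi> (y x)" for x
  have y: "filterlim y at_top at_top"
    unfolding y_def using lim N_lim by (rule filterlim_compose)
  have ev: "eventually (\<lambda>x. y x \<le> x \<and> x \<le> y' x) at_top"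
    using eventually_ge_at_top[of "s 0"] by eventually_elim (use N Suc in \<open>auto simp: y_def y'_def\<close>)
  have between: "min (\<psi> (y x)) (\<psi> (y' x)) \<le> \<Phi> x \<and> \<Phi> x \<le> max (\<psi> (y x)) (\<psi> (y' x))"
    and deriv: "\<bar>deriv \<Phi> x\<bar> \<le> 2 * \<bar>\<psi> (y' x) - \<psi> (y x)\<bar> / \<phi> (y x)"
    if "y x \<le> x \<and> x \<le> y' x" for x
    using between0[of x "Suc (N x)"] deriv0[of x "Suc (N x)"] that
    by (simp_all add: y'_def y_def s_def)
  define Q where "Q x = \<psi> (y' x) / \<psi> (y x)" for x
  define R where "R x = \<Phi> x / \<psi> (y x)" for x
  have P: "((\<lambda>x. \<psi> x / \<psi> (y x)) \<longlongrightarrow> 1) at_top"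
    using ratio_tendsto_exp[OF \<psi>_pos \<psi>_pos slowly_varying_block(1)[OF sn sv y]] ev by (simp add: y'_def)
  have Q: "(Q \<longlongrightarrow> 1) at_top"
    using ratio_tendsto_exp[OF \<psi>_pos \<psi>_pos slowly_varying_block(2)[OF sn sv y]] ev
    by (simp add: y'_def Q_def[abs_def])
  have R: "(R \<longlongrightarrow> 1) at_top"
  proof (rule tendsto_sandwich)
    have "((\<lambda>x. min 1 (Q x)) \<longlongrightarrow> min 1 1) at_top" "((\<lambda>x. max 1 (Q x)) \<longlongrightarrow> max 1 1) at_top"
      by (intro tendsto_intros Q)+
    then show "((\<lambda>x. min 1 (Q x)) \<longlongrightarrow> 1) at_top" "((\<lambda>x. max 1 (Q x)) \<longlongrightarrow> 1) at_top"
      by simp_all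
    have "min 1 (Q x) \<le> R x \<and> R x \<le> max 1 (Q x)" if "y x \<le> x \<and> x \<le> y' x" for x
      using between[OF that] \<psi>_pos[of "y x"]
      by (auto simp: Q_def R_def min_def max_def field_simps split: if_splits)
    then show "eventually (\<lambda>x. min 1 (Q x) \<le> R x) at_top" "eventually (\<lambda>x. R x \<le> max 1 (Q x)) at_top"
      using ev by (auto elim: eventually_mono)
  qed
  have "((\<lambda>x. R x / (\<psi> x / \<psi> (y x))) \<longlongrightarrow> 1 / 1) at_top"
    by (intro tendsto_divide R P) simp
  moreover have "R x / (\<psi> x / \<psi> (y x)) = \<Phi> x / \<psi> x" for x
    using \<psi>_pos[of "y x"] by (simp add: R_def)
  ultimately show "((\<lambda>x. \<Phi> x / \<psi> x) \<longlongrightarrow> 1) at_top" by (simp only: div_by_1)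
  have "((\<lambda>x. 2 * (\<phi> x / \<phi> (y x)) * \<bar>Q x - 1\<bar> / R x) \<longlongrightarrow> 2 * 1 * \<bar>1 - 1\<bar> / 1) at_top"
    using self_neglecting_block(1)[OF sn y] ev by (intro tendsto_intros Q R) (auto simp: y'_def)
  then have lim0: "((\<lambda>x. 2 * (\<phi> x / \<phi> (y x)) * \<bar>Q x - 1\<bar> / R x) \<longlongrightarrow> 0) at_top" by simp
  show "((\<lambda>x. \<phi> x * (deriv \<Phi> x / \<Phi> x)) \<longlongrightarrow> 0) at_top"
  proof (rule Lim_null_comparison[OF _ lim0])
    show "eventually (\<lambda>x. norm (\<phi> x * (deriv \<Phi> x / \<Phi> x)) \<le> 2 * (\<phi> x / \<phi> (y x)) * \<bar>Q x - 1\<bar> / R x) at_top"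
      using ev
    proof eventually_elim
      case (elim x)
      have "\<psi> (y' x) - \<psi> (y x) = \<psi> (y x) * (Q x - 1)"
        using \<psi>_pos[of "y x"] by (simp add: Q_def field_simps)
      then have abs: "\<bar>\<psi> (y' x) - \<psi> (y x)\<bar> = \<psi> (y x) * \<bar>Q x - 1\<bar>"
        using \<psi>_pos[of "y x"] by (simp add: abs_mult)
      have "norm (\<phi> x * (deriv \<Phi> x / \<Phi> x)) = \<phi> x / \<Phi> x * \<bar>deriv \<Phi> x\<bar>"
        using pos[of x] \<Phi>_pos[of x] by (simp add: abs_mult abs_divide)
      also have "\<dots> \<le> \<phi> x / \<Phi> x * (2 * (\<psi> (y x) * \<bar>Q x - 1\<bar>) / \<phi> (y x))"
        using deriv[OF elim] pos[of x] \<Phi>_pos[of x] unfolding abs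
        by (intro mult_left_mono) auto
      also have "\<dots> = 2 * (\<phi> x / \<phi> (y x)) * \<bar>Q x - 1\<bar> / R x"
        by (simp add: R_def ac_simps)
      finally show ?case .
    qed
  qed
qed

section \<open>Stability under asymptotic equivalence\<close>

text \<open>Reduces uniformity to ordinary limits: select at each \<open>x\<close> a parameter
  violating the estimate if there is one. Convergence along this selection says that eventually
  there is none.\<close>

lemma uniform_limit_choice:
  fixes f :: "'a \<Rightarrow> 'b \<Rightarrow> 'c :: metric_space"
  assumes "\<And>t. (\<And>x. t x \<in> K) \<Longrightarrow> ((\<lambda>x. f x (t x)) \<longlongrightarrow> l) F"
  shows "uniform_limit K f (\<lambda>_. l) F"
proof (cases "K = {}")
  case False
  then obtain k where k: "k \<in> K" by blast
  show ?thesis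
  proof (rule uniform_limitI)
    fix \<epsilon> :: real assume "0 < \<epsilon>"
    define t where "t x = (if \<exists>z\<in>K. \<not> dist (f x z) l < \<epsilon> then SOME z. z \<in> K \<and> \<not> dist (f x z) l < \<epsilon> else k)" for x
    have t: "t x \<in> K \<and> ((\<exists>z\<in>K. \<not> dist (f x z) l < \<epsilon>) \<longrightarrow> \<not> dist (f x (t x)) l < \<epsilon>)" for x
    proof (cases "\<exists>z\<in>K. \<not> dist (f x z) l < \<epsilon>")
      case True
      then have "\<exists>z. z \<in> K \<and> \<not> dist (f x z) l < \<epsilon>" by blast
      from someI_ex[OF this] show ?thesis using True by (simp add: t_def)
    next
      case False
      then show ?thesis by (auto simp: t_def k)
    qed
    have "((\<lambda>x. f x (t x)) \<longlongrightarrow> l) F" using t by (intro assms) blast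
    from tendstoD[OF this \<open>0 < \<epsilon>\<close>]
    show "eventually (\<lambda>x. \<forall>z\<in>K. dist (f x z) l < \<epsilon>) F"
      by eventually_elim (use t in blast)
  qed
qed (simp add: uniform_limit_iff)

text \<open>A step of \<open>t x * \<Phi> x\<close> is a step of \<open>u x * \<psi> x\<close> with
  \<open>u x = t x * (\<Phi> x / \<psi> x)\<close>, which stays bounded. The required ratio then
  factors into three ratios tending to 1.\<close>

lemma self_neglecting_asymp_equiv:
  assumes sn: "self_neglecting \<psi>" and \<Phi>_pos: "\<And>x. 0 < \<Phi> x"
    and r: "((\<lambda>x. \<Phi> x / \<psi> x) \<longlongrightarrow> 1) at_top"
  shows "self_neglecting \<Phi>"
  unfolding self_neglecting_def
proof (intro conjI allI impI \<Phi>_pos uniform_limit_choice)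
  fix K :: "real set" and t :: "real \<Rightarrow> real"
  assume "compact K" and t: "\<And>x. t x \<in> K"
  note pos = self_neglecting_pos[OF sn]
  obtain B where B: "\<And>k. k \<in> K \<Longrightarrow> \<bar>k\<bar> \<le> B"
    using compact_imp_bounded[OF \<open>compact K\<close>] unfolding bounded_iff by auto
  define u where "u x = t x * (\<Phi> x / \<psi> x)" for x
  have "eventually (\<lambda>x. \<Phi> x / \<psi> x < 2) at_top"
    using r by (rule order_tendstoD) simp
  then have u: "eventually (\<lambda>x. \<bar>u x\<bar> \<le> B * 2) at_top"
  proof eventually_elim
    case (elim x)
    have "0 < \<Phi> x / \<psi> x" using \<Phi>_pos pos by simp
    then show ?case
      unfolding u_def abs_mult using elim B[OF t[of x]] by (intro mult_mono) auto
  qed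
  define z where "z x = x + u x * \<psi> x" for x
  have z: "filterlim z at_top at_top" and \<psi>z: "((\<lambda>x. \<psi> (z x) / \<psi> x) \<longlongrightarrow> 1) at_top"
    unfolding z_def
    using self_neglecting_shift_at_top[OF sn filterlim_ident u]
      self_neglecting_ratio_tendsto[OF sn filterlim_ident u] by simp_all
  have "((\<lambda>x. (\<Phi> (z x) / \<psi> (z x)) * (\<psi> (z x) / \<psi> x) / (\<Phi> x / \<psi> x)) \<longlongrightarrow> 1 * 1 / 1) at_top"
    by (intro tendsto_intros r \<psi>z filterlim_compose[OF r z]) simp
  moreover have "(\<Phi> (z x) / \<psi> (z x)) * (\<psi> (z x) / \<psi> x) / (\<Phi> x / \<psi> x) = \<Phi> (x + t x * \<Phi> x) / \<Phi> x" for x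
  proof -
    have "z x = x + t x * \<Phi> x" using pos[of x] by (simp add: z_def u_def)
    then show ?thesis using pos[of x] pos[of "z x"] by simp
  qed
  ultimately show "((\<lambda>x. \<Phi> (x + t x * \<Phi> x) / \<Phi> x) \<longlongrightarrow> 1) at_top"
    by (simp only: mult_1 div_by_1)
qed

text \<open>Rescaling replaces the constant \<open>t\<close> by a multiplier \<open>u x\<close> that
  merely tends to \<open>t\<close>. Uniform convergence absorbs this variation, and the leftover
  term \<open>\<rho> * u x\<close> gives the index.\<close>

lemma regularly_varying_asymp_equiv:
  assumes sn: "self_neglecting \<psi>" and \<Phi>_pos: "\<And>x. 0 < \<Phi> x"
    and r: "((\<lambda>x. \<Phi> x / \<psi> x) \<longlongrightarrow> 1) at_top"
    and f: "beurling_regularly_varying \<psi> \<rho> f"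
  shows "beurling_regularly_varying \<Phi> \<rho> f"
  unfolding beurling_regularly_varying_def
proof (intro conjI allI)
  note pos = self_neglecting_pos[OF sn]
  note f_pos = beurling_regularly_varying_pos[OF f]
  show "0 < f x" for x by (rule f_pos)
  show "baire_fun f \<or> f \<in> borel_measurable lebesgue"
    using f unfolding beurling_regularly_varying_def by blast
  fix t
  define u where "u x = t * (\<Phi> x / \<psi> x)" for x
  have u_lim: "(u \<longlongrightarrow> t * 1) at_top"
    unfolding u_def by (intro tendsto_intros r)
  have "eventually (\<lambda>x. \<bar>u x\<bar> < \<bar>t * 1\<bar> + 1) at_top"
    by (rule order_tendstoD(2)[OF tendsto_rabs[OF u_lim]]) simp
  then have "eventually (\<lambda>x. \<bar>u x\<bar> \<le> \<bar>t * 1\<bar> + 1) at_top"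
    by eventually_elim simp
  from beurling_uniform_ratio_tendsto[OF sn f filterlim_ident this]
  have "((\<lambda>x. (ln (f (x + u x * \<psi> x)) - ln (f x) - \<rho> * u x) + \<rho> * u x) \<longlongrightarrow> 0 + \<rho> * (t * 1)) at_top"
    by (intro tendsto_intros u_lim)
  moreover have "u x * \<psi> x = t * \<Phi> x" for x using pos[of x] by (simp add: u_def)
  ultimately have "((\<lambda>x. ln (f (x + t * \<Phi> x)) - ln (f x)) \<longlongrightarrow> \<rho> * t) at_top"
    by simp
  then show "((\<lambda>x. f (x + t * \<Phi> x) / f x) \<longlongrightarrow> exp (\<rho> * t)) at_top"
    by (intro ratio_tendsto_exp f_pos)
qed

text \<open>Here the step function stays the same and only the varying function is replaced, so the
  pointwise limit for \<open>\<psi>\<close> is enough once the shifted points are known to tend to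
  infinity.\<close>

lemma slowly_varying_asymp_equiv:
  assumes sn: "self_neglecting \<phi>" and sv: "beurling_slowly_varying \<phi> \<psi>"
    and \<Phi>_pos: "\<And>x. 0 < \<Phi> x" and meas: "baire_fun \<Phi> \<or> \<Phi> \<in> borel_measurable lebesgue"
    and r: "((\<lambda>x. \<Phi> x / \<psi> x) \<longlongrightarrow> 1) at_top"
  shows "beurling_slowly_varying \<phi> \<Phi>"
  unfolding beurling_slowly_varying_def
proof (intro conjI allI \<Phi>_pos meas)
  fix t
  have \<psi>_pos: "0 < \<psi> x" for x using sv unfolding beurling_slowly_varying_def by blast
  define z where "z x = x + t * \<phi> x" for x
  have z: "filterlim z at_top at_top"
    unfolding z_def
    using self_neglecting_shift_at_top[OF sn filterlim_ident, of "\<lambda>_. t" "\<bar>t\<bar>"] by simp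
  have \<psi>z: "((\<lambda>x. \<psi> (z x) / \<psi> x) \<longlongrightarrow> 1) at_top"
    using sv unfolding beurling_slowly_varying_def z_def by blast
  have "((\<lambda>x. (\<Phi> (z x) / \<psi> (z x)) * (\<psi> (z x) / \<psi> x) / (\<Phi> x / \<psi> x)) \<longlongrightarrow> 1 * 1 / 1) at_top"
    by (intro tendsto_intros r \<psi>z filterlim_compose[OF r z]) simp
  moreover have "(\<Phi> (z x) / \<psi> (z x)) * (\<psi> (z x) / \<psi> x) / (\<Phi> x / \<psi> x) = \<Phi> (z x) / \<Phi> x" for x
    using \<psi>_pos[of x] \<psi>_pos[of "z x"] by simp
  ultimately show "((\<lambda>x. \<Phi> (x + t * \<phi> x) / \<Phi> x) \<longlongrightarrow> 1) at_top"
    by (simp only: mult_1 div_by_1 z_def)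
qed

lemma measurability_quotient_continuous:
  fixes \<psi> E :: "real \<Rightarrow> real"
  assumes "continuous_on UNIV E" "\<And>x. 0 < E x"
  shows "baire_fun \<psi> \<longrightarrow> baire_fun (\<lambda>x. \<psi> x / E x)"
    and "\<psi> \<in> borel_measurable lebesgue \<longrightarrow> (\<lambda>x. \<psi> x / E x) \<in> borel_measurable lebesgue"
proof -
  show "baire_fun \<psi> \<longrightarrow> baire_fun (\<lambda>x. \<psi> x / E x)"
    unfolding baire_fun_iff_measurable
    using continuous_imp_measurable_baire[OF assms(1)] by (auto intro: borel_measurable_divide)
  have "E \<in> borel_measurable lebesgue"
    using assms(1) by (intro measurable_completion) (simp add: borel_measurable_continuous_onI)
  then show "\<psi> \<in> borel_measurable lebesgue \<longrightarrow> (\<lambda>x. \<psi> x / E x) \<in> borel_measurable lebesgue"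
    by (auto intro: borel_measurable_divide)
qed

section \<open>Integral representations\<close>

text \<open>The factor \<open>c\<close> is the quotient of \<open>\<psi>\<close> by the exponential,
  so only its limit is at stake. Both \<open>ln (\<psi> x)\<close> and the primitive at
  \<open>x\<close> differ by o(1) from \<open>ln (\<psi> (y x))\<close>, the former by uniform
  convergence, the latter by the interpolation bound. The divisor is continuous, hence
  \<open>c\<close> inherits the regularity of \<open>\<psi>\<close>.\<close>

lemma slowly_varying_representation:
  assumes sn: "self_neglecting \<phi>" and sv: "beurling_regularly_varying \<phi> 0 \<psi>"
    and meas: "\<phi> \<in> borel_measurable lebesgue"
  shows "\<exists>c e :: real \<Rightarrow> real.
           (\<forall>x. 0 < c x) \<and> (c \<longlongrightarrow> 1) at_top \<and>
           e C1_differentiable_on UNIV \<and> (e \<longlongrightarrow> 0) at_top \<and>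
           (\<forall>x. interval_lebesgue_integrable lebesgue 0 (ereal x) (\<lambda>u. e u / \<phi> u) \<and>
                \<psi> x = c x * exp (LINT u=0..ereal x|lebesgue. (e u / \<phi> u))) \<and>
           (baire_fun \<psi> \<longrightarrow> baire_fun c) \<and>
           (\<psi> \<in> borel_measurable lebesgue \<longrightarrow> c \<in> borel_measurable lebesgue)"
proof -
  note pos = self_neglecting_pos[OF sn]
  note \<psi>_pos = beurling_regularly_varying_pos[OF sv]
  obtain e y C where e: "e C1_differentiable_on UNIV"
    and int: "\<And>a b. (\<lambda>u. e u / \<phi> u) absolutely_integrable_on {a..b}"
    and e0: "\<And>x. x \<le> 0 \<Longrightarrow> e x = 0" and y: "filterlim y at_top at_top"
    and ev: "eventually (\<lambda>x. y x \<le> x \<and> x \<le> y x + \<phi> (y x) \<and>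
       \<bar>e x\<bar> \<le> C * \<bar>ln (\<psi> (y x + \<phi> (y x))) - ln (\<psi> (y x))\<bar> \<and>
       \<bar>integral {0..x} (\<lambda>u. e u / \<phi> u) - ln (\<psi> (y x))\<bar>
         \<le> \<bar>ln (\<psi> (y x + \<phi> (y x))) - ln (\<psi> (y x))\<bar>) at_top"
    by (rule primitive_interpolation[OF sn meas, where g = "\<lambda>x. ln (\<psi> x)"]) (rule that; assumption)
  have block: "eventually (\<lambda>x. y x \<le> x \<and> x \<le> y x + \<phi> (y x)) at_top"
    using ev by eventually_elim blast
  note lim = slowly_varying_block[OF sn sv y block]
  define E where "E x = (LINT u=0..ereal x|lebesgue. (e u / \<phi> u))" for x
  have e0': "e x / \<phi> x = 0" if "x \<le> 0" for x using e0[OF that] by simp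
  note E = interval_lebesgue_integral_vanishing[OF int e0', folded E_def]
  define c where "c x = \<psi> x / exp (E x)" for x
  have \<Delta>0: "((\<lambda>x. C * \<bar>ln (\<psi> (y x + \<phi> (y x))) - ln (\<psi> (y x))\<bar>) \<longlongrightarrow> 0) at_top" for C
    using tendsto_mult[OF tendsto_const[of C] tendsto_rabs[OF lim(2)]] by simp
  have e_lim: "(e \<longlongrightarrow> 0) at_top"
    by (rule Lim_null_comparison[OF _ \<Delta>0[of C]]) (use ev in eventually_elim, simp)
  have "((\<lambda>x. E x - ln (\<psi> (y x))) \<longlongrightarrow> 0) at_top"
    by (rule Lim_null_comparison[OF _ \<Delta>0[of 1]]) (use ev in eventually_elim, simp add: E(1))
  then have "((\<lambda>x. (ln (\<psi> x) - ln (\<psi> (y x))) - (E x - ln (\<psi> (y x)))) \<longlongrightarrow> 0 - 0) at_top"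
    by (intro tendsto_diff lim)
  then have "((\<lambda>x. ln (\<psi> x) - ln (exp (E x))) \<longlongrightarrow> 0) at_top" by simp
  then have "((\<lambda>x. \<psi> x / exp (E x)) \<longlongrightarrow> exp 0) at_top"
    by (intro ratio_tendsto_exp \<psi>_pos) simp
  then have "(c \<longlongrightarrow> 1) at_top" by (simp add: c_def[abs_def])
  moreover have "continuous_on UNIV (\<lambda>x. exp (E x))"
    by (intro continuous_intros E(2))
  from measurability_quotient_continuous[OF this, of \<psi>]
  have "baire_fun \<psi> \<longrightarrow> baire_fun c" "\<psi> \<in> borel_measurable lebesgue \<longrightarrow> c \<in> borel_measurable lebesgue"
    by (simp_all add: c_def[abs_def])
  moreover have "0 < c x" "\<psi> x = c x * exp (E x)" for x
    using \<psi>_pos[of x] by (simp_all add: c_def)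
  ultimately show ?thesis
    using e e_lim interval_lebesgue_integral_0_real(1)[OF int] unfolding E_def by blast
qed

text \<open>Increments of \<open>\<Phi>\<close> between nodes are small only relative to
  \<open>\<Phi>\<close>. The bump function \<open>d\<close> is thus o(\<open>\<Phi>\<close>), which
  makes \<open>d u / \<Phi> u\<close> small, and the same relative bound makes its primitive
  asymptotic to \<open>\<Phi>\<close>.\<close>

lemma self_neglecting_integral_representation:
  assumes sn: "self_neglecting \<Phi>" and cont: "continuous_on UNIV \<Phi>"
  shows "\<exists>e :: real \<Rightarrow> real. continuous_on UNIV e \<and> (e \<longlongrightarrow> 0) at_top \<and>
            \<Phi> \<sim>[at_top] (\<lambda>x. LINT u=0..ereal x|lebesgue. (e u))"
proof -
  note pos = self_neglecting_pos[OF sn]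
  have "\<Phi> \<in> borel_measurable lebesgue"
    using cont by (intro measurable_completion) (simp add: borel_measurable_continuous_onI)
  then obtain d y C where d: "d C1_differentiable_on UNIV"
    and int: "\<And>a b. (\<lambda>u. d u / \<Phi> u) absolutely_integrable_on {a..b}"
    and d0: "\<And>x. x \<le> 0 \<Longrightarrow> d x = 0" and y: "filterlim y at_top at_top"
    and ev: "eventually (\<lambda>x. y x \<le> x \<and> x \<le> y x + \<Phi> (y x) \<and>
       \<bar>d x\<bar> \<le> C * \<bar>\<Phi> (y x + \<Phi> (y x)) - \<Phi> (y x)\<bar> \<and>
       \<bar>integral {0..x} (\<lambda>u. d u / \<Phi> u) - \<Phi> (y x)\<bar> \<le> \<bar>\<Phi> (y x + \<Phi> (y x)) - \<Phi> (y x)\<bar>) at_top"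
    by (rule primitive_interpolation[OF sn, where g = \<Phi>]) (rule that; assumption)
  have block: "eventually (\<lambda>x. y x \<le> x \<and> x \<le> y x + \<Phi> (y x)) at_top"
    using ev by eventually_elim blast
  note lim = self_neglecting_block[OF sn y block]
  define Q where "Q x = \<Phi> (y x + \<Phi> (y x)) / \<Phi> (y x)" for x
  define R where "R x = \<Phi> x / \<Phi> (y x)" for x
  have Q: "(Q \<longlongrightarrow> 1) at_top" and R: "(R \<longlongrightarrow> 1) at_top"
    using lim by (simp_all add: Q_def[abs_def] R_def[abs_def])
  have \<Delta>: "\<bar>\<Phi> (y x + \<Phi> (y x)) - \<Phi> (y x)\<bar> = \<Phi> (y x) * \<bar>Q x - 1\<bar>" for x
  proof -
    have "\<Phi> (y x + \<Phi> (y x)) - \<Phi> (y x) = \<Phi> (y x) * (Q x - 1)"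
      using pos[of "y x"] by (simp add: Q_def field_simps)
    then show ?thesis using pos[of "y x"] by (simp add: abs_mult)
  qed
  \<comment> \<open>The division by \<open>\<Phi>\<close> limits the smoothness of this integrand to
    that of \<open>\<Phi>\<close>, which is continuous here.\<close>
  define e where "e u = d u / \<Phi> u" for u
  define E where "E x = (LINT u=0..ereal x|lebesgue. (e u))" for x
  have e0: "e x = 0" if "x \<le> 0" for x using d0[OF that] by (simp add: e_def)
  have e_int: "e absolutely_integrable_on {a..b}" for a b
    using int[of a b] by (simp add: e_def[abs_def])
  have E: "E x = integral {0..x} e" for x
    unfolding E_def by (rule interval_lebesgue_integral_vanishing(1)[OF e_int e0])
  have e_cont: "continuous_on UNIV e"
    unfolding e_def using C1_differentiable_imp_continuous_on[OF d] cont pos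
    by (intro continuous_intros) (auto simp: less_imp_neq[THEN not_sym])
  have "((\<lambda>x. C * \<bar>Q x - 1\<bar> / R x) \<longlongrightarrow> C * \<bar>1 - 1\<bar> / 1) at_top"
    by (intro tendsto_intros Q R) simp
  then have lim0: "((\<lambda>x. C * \<bar>Q x - 1\<bar> / R x) \<longlongrightarrow> 0) at_top" by simp
  have e_lim: "(e \<longlongrightarrow> 0) at_top"
  proof (rule Lim_null_comparison[OF _ lim0])
    show "eventually (\<lambda>x. norm (e x) \<le> C * \<bar>Q x - 1\<bar> / R x) at_top"
      using ev
    proof eventually_elim
      case (elim x)
      have "norm (e x) = \<bar>d x\<bar> / \<Phi> x" using pos[of x] by (simp add: e_def abs_divide)
      also have "\<dots> \<le> C * (\<Phi> (y x) * \<bar>Q x - 1\<bar>) / \<Phi> x"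
        using elim pos[of x] unfolding \<Delta> by (intro divide_right_mono) auto
      also have "\<dots> = C * \<bar>Q x - 1\<bar> / R x" by (simp add: R_def)
      finally show ?case .
    qed
  qed
  have "((\<lambda>x. \<bar>Q x - 1\<bar>) \<longlongrightarrow> \<bar>1 - 1\<bar>) at_top"
    by (intro tendsto_intros Q)
  then have lim1: "((\<lambda>x. \<bar>Q x - 1\<bar>) \<longlongrightarrow> 0) at_top" by simp
  have "((\<lambda>x. E x / \<Phi> (y x) - 1) \<longlongrightarrow> 0) at_top"
  proof (rule Lim_null_comparison[OF _ lim1])
    show "eventually (\<lambda>x. norm (E x / \<Phi> (y x) - 1) \<le> \<bar>Q x - 1\<bar>) at_top"
      using ev
    proof eventually_elim
      case (elim x)
      have "\<bar>E x - \<Phi> (y x)\<bar> \<le> \<Phi> (y x) * \<bar>Q x - 1\<bar>"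
        using elim unfolding E e_def[abs_def] \<Delta> by blast
      moreover have "\<bar>E x - \<Phi> (y x)\<bar> = \<Phi> (y x) * \<bar>E x / \<Phi> (y x) - 1\<bar>"
      proof -
        have "E x - \<Phi> (y x) = \<Phi> (y x) * (E x / \<Phi> (y x) - 1)"
          using pos[of "y x"] by (simp add: field_simps)
        then show ?thesis using pos[of "y x"] by (metis abs_mult abs_of_pos)
      qed
      ultimately show ?case using pos[of "y x"] by simp
    qed
  qed
  then have "((\<lambda>x. E x / \<Phi> (y x)) \<longlongrightarrow> 1) at_top"
    by (rule LIM_zero_cancel)
  then have "((\<lambda>x. R x / (E x / \<Phi> (y x))) \<longlongrightarrow> 1 / 1) at_top"
    by (intro tendsto_divide R) simp_all
  moreover have "R x / (E x / \<Phi> (y x)) = \<Phi> x / E x" for x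
    using pos[of "y x"] by (simp add: R_def)
  ultimately have "((\<lambda>x. \<Phi> x / E x) \<longlongrightarrow> 1) at_top" by (simp only: div_by_1)
  then have "\<Phi> \<sim>[at_top] E" by (rule asymp_equivI')
  then show ?thesis
    using e_cont e_lim unfolding E_def[abs_def] by blast
qed

theorem theorem4:
  fixes \<phi> \<psi> \<Phi> :: "real \<Rightarrow> real"
  assumes "self_neglecting \<phi>"
    and "beurling_slowly_varying \<phi> \<psi>"
    and "interpolates \<phi> \<psi> \<Phi>"
  shows
    "(\<exists>c :: real \<Rightarrow> real.
        (\<forall>x. 0 < c x) \<and> (c \<longlongrightarrow> 1) at_top \<and> (\<forall>x. \<psi> x = c x * \<Phi> x) \<and>
        (baire_fun \<psi> \<longrightarrow> baire_fun c) \<and>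
        (\<psi> \<in> borel_measurable lebesgue \<longrightarrow> c \<in> borel_measurable lebesgue) \<and>
        (\<exists>e :: real \<Rightarrow> real.
           (e \<longlongrightarrow> 0) at_top \<and>
           (\<phi> C1_differentiable_on UNIV \<and> deriv \<Phi> C1_differentiable_on UNIV \<longrightarrow>
              e C1_differentiable_on UNIV) \<and>
           (\<forall>x. interval_lebesgue_integrable lebesgue 0 (ereal x) (\<lambda>u. e u / \<phi> u) \<and>
                \<Phi> x = \<Phi> 0 * exp (LINT u=0..ereal x|lebesgue. (e u / \<phi> u)))))
     \<and> \<psi> \<sim>[at_top] \<Phi>
     \<and> \<Phi> C1_differentiable_on UNIV
     \<and> beurling_slowly_varying \<phi> \<Phi>
     \<and> ((\<lambda>x. \<bar>\<phi> x * (deriv \<Phi> x / \<Phi> x)\<bar>) \<longlongrightarrow> 0) at_top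
     \<and> (\<phi> \<in> borel_measurable lebesgue \<longrightarrow>
        (\<exists>c e :: real \<Rightarrow> real.
           (\<forall>x. 0 < c x) \<and> (c \<longlongrightarrow> 1) at_top \<and>
           e C1_differentiable_on UNIV \<and> (e \<longlongrightarrow> 0) at_top \<and>
           (\<forall>x. interval_lebesgue_integrable lebesgue 0 (ereal x) (\<lambda>u. e u / \<phi> u) \<and>
                \<psi> x = c x * exp (LINT u=0..ereal x|lebesgue. (e u / \<phi> u))) \<and>
           (baire_fun \<psi> \<longrightarrow> baire_fun c) \<and>
           (\<psi> \<in> borel_measurable lebesgue \<longrightarrow> c \<in> borel_measurable lebesgue)))
     \<and> (self_neglecting \<psi> \<longrightarrow>
        (self_neglecting \<Phi> \<and> \<psi> \<sim>[at_top] \<Phi> \<and>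
         (\<exists>e :: real \<Rightarrow> real. continuous_on UNIV e \<and> (e \<longlongrightarrow> 0) at_top \<and>
            \<Phi> \<sim>[at_top] (\<lambda>x. LINT u=0..ereal x|lebesgue. (e u))))
        \<and> (((\<lambda>x. \<Phi> x / x) \<longlongrightarrow> 0) at_top \<and> ((\<lambda>x. \<psi> x / x) \<longlongrightarrow> 0) at_top)
        \<and> (\<forall>f \<rho>. beurling_regularly_varying \<psi> \<rho> f \<longrightarrow>
             beurling_regularly_varying \<Phi> \<rho> f \<and>
             \<psi> \<sim>[at_top] \<Phi> \<and> \<Phi> C1_differentiable_on UNIV \<and> self_neglecting \<Phi>))"
proof -
  note sn = assms(1) and ip = assms(3)
  have sv: "beurling_regularly_varying \<phi> 0 \<psi>"
    using assms(2) by (simp add: beurling_slowly_varying_iff)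
  note pos = self_neglecting_pos[OF sn]
  note \<psi>_pos = beurling_regularly_varying_pos[OF sv]
  have \<Phi>_pos: "\<And>x. 0 < \<Phi> x" and \<Phi>_C1: "\<Phi> C1_differentiable_on UNIV"
    using ip unfolding interpolates_def by blast+
  note \<Phi>_deriv = C1_differentiable_on_UNIV_deriv[OF \<Phi>_C1]
  note r = interpolation_asymptotics(1)[OF sn sv ip]
  note log_deriv = interpolation_asymptotics(2)[OF sn sv ip]
  have \<Phi>_meas: "\<Phi> \<in> borel_measurable lebesgue"
    using \<Phi>_deriv(3) by (intro measurable_completion) (simp add: borel_measurable_continuous_onI)
  define c where "c x = \<psi> x / \<Phi> x" for x
  have c_lim: "(c \<longlongrightarrow> 1) at_top"
    using tendsto_inverse[OF r] by (simp add: c_def[abs_def])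
  have equiv: "\<psi> \<sim>[at_top] \<Phi>"
    using c_lim by (intro asymp_equivI') (simp add: c_def[abs_def])
  \<comment> \<open>With this choice \<open>e u / \<phi> u\<close> is the logarithmic derivative of
    \<open>\<Phi>\<close>, a continuous function even where \<open>\<phi>\<close> is
    irregular.\<close>
  define e where "e x = \<phi> x * (deriv \<Phi> x / \<Phi> x)" for x
  have e_div: "(\<lambda>u. e u / \<phi> u) = (\<lambda>u. deriv \<Phi> u / \<Phi> u)"
    using pos by (auto simp: e_def less_imp_neq[THEN not_sym])
  have e_lim: "(e \<longlongrightarrow> 0) at_top" using log_deriv by (simp add: e_def[abs_def])
  have e_C1: "e C1_differentiable_on UNIV"
    if "\<phi> C1_differentiable_on UNIV" "deriv \<Phi> C1_differentiable_on UNIV"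
  proof -
    have "(\<lambda>x. inverse (\<Phi> x)) C1_differentiable_on UNIV"
      using \<Phi>_pos by (intro C1_differentiable_on_UNIV_inverse \<Phi>_C1) (simp add: less_imp_neq[THEN not_sym])
    then show ?thesis
      unfolding e_def divide_inverse by (intro C1_differentiable_on_mult that)
  qed
  have ln_deriv: "((\<lambda>x. ln (\<Phi> x)) has_real_derivative deriv \<Phi> x / \<Phi> x) (at x)" for x
    using \<Phi>_pos[of x] by (auto intro!: derivative_eq_intros \<Phi>_deriv(1))
  have ln_cont: "continuous_on UNIV (\<lambda>x. deriv \<Phi> x / \<Phi> x)"
    using \<Phi>_pos by (intro continuous_intros \<Phi>_deriv) (auto simp: less_imp_neq[THEN not_sym])
  note e_int = interval_lebesgue_integral_derivative[OF ln_deriv ln_cont, folded e_div]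
  \<comment> \<open>The integral from 0 equals \<open>ln (\<Phi> x) - ln (\<Phi> 0)\<close>, so the
    exponential is 1 at 0 and the initial value must appear as a factor.\<close>
  have \<Phi>_exp: "\<Phi> x = \<Phi> 0 * exp (LINT u=0..ereal x|lebesgue. (e u / \<phi> u))" for x
    unfolding e_int(2) using \<Phi>_pos[of x] \<Phi>_pos[of 0] by (simp add: exp_diff)
  have repr_e: "\<exists>e :: real \<Rightarrow> real.
           (e \<longlongrightarrow> 0) at_top \<and>
           (\<phi> C1_differentiable_on UNIV \<and> deriv \<Phi> C1_differentiable_on UNIV \<longrightarrow>
              e C1_differentiable_on UNIV) \<and>
           (\<forall>x. interval_lebesgue_integrable lebesgue 0 (ereal x) (\<lambda>u. e u / \<phi> u) \<and>
                \<Phi> x = \<Phi> 0 * exp (LINT u=0..ereal x|lebesgue. (e u / \<phi> u)))"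
    using e_lim e_C1 e_int(1) \<Phi>_exp by blast
  have repr: "\<exists>c :: real \<Rightarrow> real.
        (\<forall>x. 0 < c x) \<and> (c \<longlongrightarrow> 1) at_top \<and> (\<forall>x. \<psi> x = c x * \<Phi> x) \<and>
        (baire_fun \<psi> \<longrightarrow> baire_fun c) \<and>
        (\<psi> \<in> borel_measurable lebesgue \<longrightarrow> c \<in> borel_measurable lebesgue) \<and>
        (\<exists>e :: real \<Rightarrow> real.
           (e \<longlongrightarrow> 0) at_top \<and>
           (\<phi> C1_differentiable_on UNIV \<and> deriv \<Phi> C1_differentiable_on UNIV \<longrightarrow>
              e C1_differentiable_on UNIV) \<and>
           (\<forall>x. interval_lebesgue_integrable lebesgue 0 (ereal x) (\<lambda>u. e u / \<phi> u) \<and>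
                \<Phi> x = \<Phi> 0 * exp (LINT u=0..ereal x|lebesgue. (e u / \<phi> u))))"
  proof (rule exI[of _ c], intro conjI allI impI c_lim repr_e)
    show "0 < c x" "\<psi> x = c x * \<Phi> x" for x
      using \<psi>_pos[of x] \<Phi>_pos[of x] by (simp_all add: c_def)
    show "baire_fun c" if "baire_fun \<psi>"
      using measurability_quotient_continuous(1)[OF \<Phi>_deriv(3) \<Phi>_pos, of \<psi>] that by (simp add: c_def[abs_def])
    show "c \<in> borel_measurable lebesgue" if "\<psi> \<in> borel_measurable lebesgue"
      using measurability_quotient_continuous(2)[OF \<Phi>_deriv(3) \<Phi>_pos, of \<psi>] that by (simp add: c_def[abs_def])
  qed
  have \<Phi>_sv: "beurling_slowly_varying \<phi> \<Phi>"
    using slowly_varying_asymp_equiv[OF sn assms(2) \<Phi>_pos _ r] \<Phi>_meas by blast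
  have abs_lim: "((\<lambda>x. \<bar>\<phi> x * (deriv \<Phi> x / \<Phi> x)\<bar>) \<longlongrightarrow> 0) at_top"
    using log_deriv by (rule tendsto_rabs_zero)
  have \<Phi>_sn: "self_neglecting \<Phi>" if "self_neglecting \<psi>"
    using self_neglecting_asymp_equiv[OF that \<Phi>_pos r] .
  have \<Phi>_rv: "beurling_regularly_varying \<Phi> \<rho> f"
    if "self_neglecting \<psi>" "beurling_regularly_varying \<psi> \<rho> f" for f \<rho>
    using regularly_varying_asymp_equiv[OF that(1) \<Phi>_pos r that(2)] .
  show ?thesis
  proof (intro conjI impI allI)
    show "\<exists>e :: real \<Rightarrow> real. continuous_on UNIV e \<and> (e \<longlongrightarrow> 0) at_top \<and>
            \<Phi> \<sim>[at_top] (\<lambda>x. LINT u=0..ereal x|lebesgue. (e u))" if "self_neglecting \<psi>"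
      using self_neglecting_integral_representation[OF \<Phi>_sn[OF that] \<Phi>_deriv(3)] .
    show "((\<lambda>x. \<Phi> x / x) \<longlongrightarrow> 0) at_top" if "self_neglecting \<psi>"
      using self_neglecting_sublinear[OF \<Phi>_sn[OF that]] .
    show "((\<lambda>x. \<psi> x / x) \<longlongrightarrow> 0) at_top" if "self_neglecting \<psi>"
      using self_neglecting_sublinear[OF that] .
  qed (assumption | rule repr equiv \<Phi>_C1 \<Phi>_sv abs_lim \<Phi>_sn \<Phi>_rv slowly_varying_representation[OF sn sv])+
qed

end
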